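(* Let $\mathcal{Q}=(N,g_N,\mathcal{I},\theta)$ be a $\mathfrak{Q}$-structure with $\theta=0$, let $m=\dim N+1$, and let $\tau_N$ be the (constant) scalar curvature of $(N,g_N)$. If $t\ne0$ and if $\tau_N-\frac{(m-1)(m-2)}4t^2\ne0$, then $\mathcal{M}_{t,\mathcal{Q}}$ is not flat. Moreover such a manifold $\mathcal{M}_{t,\mathcal{Q}}$ is homothety $k$-curvature homogeneous for all $k$ but is not $0$-curvature homogeneous.
   Context: A quadruple $\mathcal{Q}=(N,g_N,\mathcal{I},\theta)$ is a $\mathfrak{Q}$-structure if $\mathcal{I}$ is a connected Lie group which acts transitively and effectively by isometries on a connected pseudo-Riemannian manifold $(N,g_N)$, and if $\theta$ is a smooth $1$-form on $N$ invariant under the action of $\mathcal{I}$. When $\theta=0$, for $t\in\mathbb{R}$, $$\mathcal{M}_{t,\mathcal{Q}}:=(\mathbb{R}\times N,\;e^{tx}(dx^2+g_N)),$$ where $x$ is the coordinate on $\mathbb{R}$. The scalar curvature has the sign convention in which it is positive on round spheres of dimension at least 2. A pseudo-Riemannian manifold $(M,g)$ is $k$-curvature homogeneous if for all $P,Q\in M$ there is a linear isometry $\phi:T_PM\to T_QM$ with $\phi^*(\nabla^\ell R_Q)=\nabla^\ell R_P$ for $0\le\ell\le k$. It is homothety $k$-curvature homogeneous if for all $P,Q\in M$ there are a linear isometry $\phi:T_PM\to T_QM$ and a real $\lambda\ne0$ with $\phi^*(\nabla^\ell R_Q)=\lambda^{-\ell-2}\nabla^\ell R_P$ for $0\le\ell\le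 k$. Here $\nabla^\ell R$ is the $\ell$-th covariant derivative of the curvature tensor. *)

theory Defs
  imports "HOL-Analysis.Analysis" "HOL-Algebra.Group_Action"
begin

section \<open>Smooth maps between Euclidean spaces\<close>

text \<open>\<open>C_k_on k S f\<close> and \<open>smooth_on S f\<close> are meant for open \<open>S\<close>.\<close>

primrec C_k_on ::
  "nat \<Rightarrow> 'e::euclidean_space set \<Rightarrow> ('e \<Rightarrow> 'f::real_normed_vector) \<Rightarrow> bool" where
  "C_k_on 0 S f \<longleftrightarrow> continuous_on S f"
| "C_k_on (Suc k) S f \<longleftrightarrow>
     (\<forall>x\<in>S. f differentiable (at x)) \<and>
     (\<forall>v. C_k_on k S (\<lambda>x. frechet_derivative f (at x) v))"

definition smooth_on ::
  "'e::euclidean_space set \<Rightarrow> ('e \<Rightarrow> 'f::real_normed_vector) \<Rightarrow> bool" where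
  "smooth_on S f \<longleftrightarrow> (\<forall>k. C_k_on k S f)"


section \<open>Smooth manifolds\<close>

text \<open>
  A manifold is a topology together with a (not necessarily maximal) smooth atlas with values in
  a Euclidean space \<open>'e\<close>; its dimension is \<open>DIM('e)\<close>. A chart \<open>(U, \<phi>)\<close> only matters on \<open>U\<close>.
\<close>

type_synonym ('a, 'e) chart = "'a set \<times> ('a \<Rightarrow> 'e)"

record ('a, 'e) manifold =
  mtop :: "'a topology"
  atlas :: "('a, 'e) chart set"

abbreviation points :: "('a, 'e) manifold \<Rightarrow> 'a set" where
  "points M \<equiv> topspace (mtop M)"

abbreviation chart_inv :: "('a, 'e) chart \<Rightarrow> 'e \<Rightarrow> 'a" where
  "chart_inv c \<equiv> inv_into (fst c) (snd c)"

locale smooth_manifold =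
  fixes M :: "('a, 'e::euclidean_space) manifold"
  assumes Hausdorff: "Hausdorff_space (mtop M)"
    and second_countable:
      "\<exists>B. countable B \<and> (\<forall>V\<in>B. openin (mtop M) V) \<and>
           (\<forall>U x. openin (mtop M) U \<and> x \<in> U \<longrightarrow> (\<exists>V\<in>B. x \<in> V \<and> V \<subseteq> U))"
    and chart_domain: "(U, \<phi>) \<in> atlas M \<Longrightarrow> openin (mtop M) U"
    and chart_image: "(U, \<phi>) \<in> atlas M \<Longrightarrow> open (\<phi> ` U)"
    and chart_homeo: "(U, \<phi>) \<in> atlas M \<Longrightarrow>
          homeomorphic_map (subtopology (mtop M) U) (top_of_set (\<phi> ` U)) \<phi>"
    and chart_cover: "(\<Union>c\<in>atlas M. fst c) = points M"
    and chart_transition: "(U, \<phi>) \<in> atlas M \<Longrightarrow> (V, \<psi>) \<in> atlas M \<Longrightarrow>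
          smooth_on (\<phi> ` (U \<inter> V)) (\<psi> \<circ> inv_into U \<phi>)"

definition connected_manifold :: "('a, 'e::euclidean_space) manifold \<Rightarrow> bool" where
  "connected_manifold M \<longleftrightarrow> smooth_manifold M \<and> connected_space (mtop M) \<and> points M \<noteq> {}"

definition smooth_map ::
  "('a, 'e::euclidean_space) manifold \<Rightarrow> ('b, 'f::euclidean_space) manifold \<Rightarrow> ('a \<Rightarrow> 'b) \<Rightarrow> bool"
  where
  "smooth_map M M' f \<longleftrightarrow> continuous_map (mtop M) (mtop M') f \<and>
     (\<forall>c\<in>atlas M. \<forall>d\<in>atlas M'.
        smooth_on (snd c ` {p \<in> fst c. f p \<in> fst d}) (snd d \<circ> f \<circ> chart_inv c))"

definition product_manifold ::
  "('a, 'e) manifold \<Rightarrow> ('b, 'f) manifold \<Rightarrow> ('a \<times> 'b, 'e \<times> 'f) manifold" where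
  "product_manifold M M' =
     \<lparr>mtop = prod_topology (mtop M) (mtop M'),
      atlas = {(U \<times> V, map_prod \<phi> \<psi>) | U \<phi> V \<psi>. (U, \<phi>) \<in> atlas M \<and> (V, \<psi>) \<in> atlas M'}\<rparr>"

definition real_line :: "(real, real) manifold" where
  "real_line = \<lparr>mtop = euclideanreal, atlas = {(UNIV, \<lambda>x. x)}\<rparr>"

text \<open>
  The tangent space at \<open>p\<close> is the model space \<open>'e\<close>, a tangent vector being represented by its
  components in one preferred chart \<open>chart_at M p\<close> around \<open>p\<close>. Hence the differential of a map
  is the derivative of its expression in the preferred charts, and a tensor at \<open>p\<close> is a
  multilinear form on \<open>'e\<close>.
\<close>

definition chart_at :: "('a, 'e) manifold \<Rightarrow> 'a \<Rightarrow> ('a, 'e) chart" where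
  "chart_at M p = (SOME c. c \<in> atlas M \<and> p \<in> fst c)"

definition differential ::
  "('a, 'e::euclidean_space) manifold \<Rightarrow> ('b, 'f::euclidean_space) manifold \<Rightarrow>
     ('a \<Rightarrow> 'b) \<Rightarrow> 'a \<Rightarrow> 'e \<Rightarrow> 'f" where
  "differential M M' f p =
     frechet_derivative (snd (chart_at M' (f p)) \<circ> f \<circ> chart_inv (chart_at M p))
       (at (snd (chart_at M p) p))"

text \<open>
  \<open>chart_vector M c y v\<close> is the tangent vector at the point with coordinates \<open>y\<close> in the chart \<open>c\<close>
  whose components with respect to \<open>c\<close> are \<open>v\<close>.
\<close>

definition chart_vector ::
  "('a, 'e::euclidean_space) manifold \<Rightarrow> ('a, 'e) chart \<Rightarrow> 'e \<Rightarrow> 'e \<Rightarrow> 'e" where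
  "chart_vector M c y =
     frechet_derivative (snd (chart_at M (chart_inv c y)) \<circ> chart_inv c) (at y)"

definition smooth_one_form ::
  "('a, 'e::euclidean_space) manifold \<Rightarrow> ('a \<Rightarrow> 'e \<Rightarrow> real) \<Rightarrow> bool" where
  "smooth_one_form M \<theta> \<longleftrightarrow>
     (\<forall>p\<in>points M. linear (\<theta> p)) \<and>
     (\<forall>c\<in>atlas M. \<forall>v.
        smooth_on (snd c ` fst c) (\<lambda>y. \<theta> (chart_inv c y) (chart_vector M c y v)))"

definition invariant_one_form ::
  "('a, 'e::euclidean_space) manifold \<Rightarrow> ('a \<Rightarrow> 'a) \<Rightarrow> ('a \<Rightarrow> 'e \<Rightarrow> real) \<Rightarrow> bool" where
  "invariant_one_form M f \<theta> \<longleftrightarrow>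
     (\<forall>p\<in>points M. \<forall>v. \<theta> (f p) (differential M M f p v) = \<theta> p v)"


section \<open>Pseudo-Riemannian metrics and their curvature\<close>

definition local_metric ::
  "('a, 'e::euclidean_space) manifold \<Rightarrow> ('a \<Rightarrow> 'e \<Rightarrow> 'e \<Rightarrow> real) \<Rightarrow> ('a, 'e) chart
     \<Rightarrow> 'e \<Rightarrow> 'e \<Rightarrow> 'e \<Rightarrow> real" where
  "local_metric M g c y u v = g (chart_inv c y) (chart_vector M c y u) (chart_vector M c y v)"

text \<open>On a connected manifold the signature of such a metric is automatically constant.\<close>

locale pseudo_riemannian_manifold = smooth_manifold M
  for M :: "('a, 'e::euclidean_space) manifold" +
  fixes g :: "'a \<Rightarrow> 'e \<Rightarrow> 'e \<Rightarrow> real"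
  assumes metric_bilinear: "p \<in> points M \<Longrightarrow> bilinear (g p)"
    and metric_symmetric: "p \<in> points M \<Longrightarrow> g p u v = g p v u"
    and metric_nondegenerate: "p \<in> points M \<Longrightarrow> u \<noteq> 0 \<Longrightarrow> \<exists>v. g p u v \<noteq> 0"
    and metric_smooth: "c \<in> atlas M \<Longrightarrow>
          smooth_on (snd c ` fst c) (\<lambda>y. local_metric M g c y u v)"

definition isometry ::
  "('a, 'e::euclidean_space) manifold \<Rightarrow> ('a \<Rightarrow> 'e \<Rightarrow> 'e \<Rightarrow> real) \<Rightarrow> ('a \<Rightarrow> 'a) \<Rightarrow> bool" where
  "isometry M g f \<longleftrightarrow>
     bij_betw f (points M) (points M) \<and> smooth_map M M f \<and>
     smooth_map M M (inv_into (points M) f) \<and>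
     (\<forall>p\<in>points M. \<forall>u v.
        g (f p) (differential M M f p u) (differential M M f p v) = g p u v)"

text \<open>
  Local formulas, for a metric \<open>g\<close> given on an open subset of the model space \<open>'e\<close>, where
  \<open>g y\<close> is the inner product at \<open>y\<close>. Elements of \<open>'e\<close> are also read as constant
  (coordinate) vector fields. \<open>sharp\<close> raises an index; \<open>christoffel g y u v\<close> is
  \<open>\<nabla>\<^sub>u v\<close> for the Levi-Civita connection (Koszul formula for constant fields).
\<close>

definition sharp :: "('e::euclidean_space \<Rightarrow> 'e \<Rightarrow> 'e \<Rightarrow> real) \<Rightarrow> 'e \<Rightarrow> ('e \<Rightarrow> real) \<Rightarrow> 'e" where
  "sharp g y \<alpha> = (THE w. \<forall>z. g y w z = \<alpha> z)"

definition christoffel :: "('e::euclidean_space \<Rightarrow> 'e \<Rightarrow> 'e \<Rightarrow> real) \<Rightarrow> 'e \<Rightarrow> 'e \<Rightarrow> 'e \<Rightarrow> 'e" where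
  "christoffel g y u v = sharp g y (\<lambda>z.
     (frechet_derivative (\<lambda>x. g x v z) (at y) u
      + frechet_derivative (\<lambda>x. g x u z) (at y) v
      - frechet_derivative (\<lambda>x. g x u v) (at y) z) / 2)"

text \<open>\<open>R(u,v)w = \<nabla>\<^sub>u \<nabla>\<^sub>v w - \<nabla>\<^sub>v \<nabla>\<^sub>u w\<close> for constant fields (whose brackets vanish).\<close>

definition curvature_op ::
  "('e::euclidean_space \<Rightarrow> 'e \<Rightarrow> 'e \<Rightarrow> real) \<Rightarrow> 'e \<Rightarrow> 'e \<Rightarrow> 'e \<Rightarrow> 'e \<Rightarrow> 'e" where
  "curvature_op g y u v w =
     frechet_derivative (\<lambda>x. christoffel g x v w) (at y) u
     - frechet_derivative (\<lambda>x. christoffel g x u w) (at y) v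
     + christoffel g y u (christoffel g y v w)
     - christoffel g y v (christoffel g y u w)"

text \<open>
  A covariant tensor of valence \<open>r\<close> is evaluated on lists of length \<open>r\<close>; its value on lists of
  another length is irrelevant. The differentiation direction is the first argument of a
  covariant derivative.
\<close>

definition curvature_tensor ::
  "('e::euclidean_space \<Rightarrow> 'e \<Rightarrow> 'e \<Rightarrow> real) \<Rightarrow> 'e \<Rightarrow> 'e list \<Rightarrow> real" where
  "curvature_tensor g y vs = g y (curvature_op g y (vs ! 0) (vs ! 1) (vs ! 2)) (vs ! 3)"

definition covariant_derivative ::
  "('e::euclidean_space \<Rightarrow> 'e \<Rightarrow> 'e \<Rightarrow> real) \<Rightarrow> ('e \<Rightarrow> 'e list \<Rightarrow> real) \<Rightarrow> 'e \<Rightarrow> 'e list \<Rightarrow> real"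
  where
  "covariant_derivative g T y vs =
     (let u = hd vs; ws = tl vs in
        frechet_derivative (\<lambda>x. T x ws) (at y) u
        - (\<Sum>i<length ws. T y (ws[i := christoffel g y u (ws ! i)])))"

primrec nabla_curvature ::
  "nat \<Rightarrow> ('e::euclidean_space \<Rightarrow> 'e \<Rightarrow> 'e \<Rightarrow> real) \<Rightarrow> 'e \<Rightarrow> 'e list \<Rightarrow> real" where
  "nabla_curvature 0 g = curvature_tensor g"
| "nabla_curvature (Suc l) g = covariant_derivative g (nabla_curvature l g)"

text \<open>
  The Ricci tensor is the trace of \<open>u \<mapsto> R(u,v)w\<close>, and the scalar curvature is the trace of
  the Ricci operator; this is positive on round spheres of dimension at least 2.
\<close>

definition ricci ::
  "('e::euclidean_space \<Rightarrow> 'e \<Rightarrow> 'e \<Rightarrow> real) \<Rightarrow> 'e \<Rightarrow> 'e \<Rightarrow> 'e \<Rightarrow> real" where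
  "ricci g y v w = (\<Sum>b\<in>Basis. curvature_op g y b v w \<bullet> b)"

definition local_scalar_curvature ::
  "('e::euclidean_space \<Rightarrow> 'e \<Rightarrow> 'e \<Rightarrow> real) \<Rightarrow> 'e \<Rightarrow> real" where
  "local_scalar_curvature g y = (\<Sum>b\<in>Basis. sharp g y (ricci g y b) \<bullet> b)"

text \<open>The corresponding objects on a manifold, computed at \<open>p\<close> in the preferred chart at \<open>p\<close>.\<close>

definition nabla_R ::
  "('a, 'e::euclidean_space) manifold \<Rightarrow> ('a \<Rightarrow> 'e \<Rightarrow> 'e \<Rightarrow> real) \<Rightarrow> nat \<Rightarrow> 'a \<Rightarrow> 'e list \<Rightarrow> real"
  where
  "nabla_R M g l p =
     nabla_curvature l (local_metric M g (chart_at M p)) (snd (chart_at M p) p)"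

definition scalar_curvature ::
  "('a, 'e::euclidean_space) manifold \<Rightarrow> ('a \<Rightarrow> 'e \<Rightarrow> 'e \<Rightarrow> real) \<Rightarrow> 'a \<Rightarrow> real" where
  "scalar_curvature M g p =
     local_scalar_curvature (local_metric M g (chart_at M p)) (snd (chart_at M p) p)"

definition flat ::
  "('a, 'e::euclidean_space) manifold \<Rightarrow> ('a \<Rightarrow> 'e \<Rightarrow> 'e \<Rightarrow> real) \<Rightarrow> bool" where
  "flat M g \<longleftrightarrow> (\<forall>p\<in>points M. \<forall>vs. length vs = 4 \<longrightarrow> nabla_R M g 0 p vs = 0)"


section \<open>Curvature homogeneity\<close>

definition linear_isometry ::
  "('a \<Rightarrow> 'e::euclidean_space \<Rightarrow> 'e \<Rightarrow> real) \<Rightarrow> 'a \<Rightarrow> 'a \<Rightarrow> ('e \<Rightarrow> 'e) \<Rightarrow> bool" where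
  "linear_isometry g P Q \<phi> \<longleftrightarrow> linear \<phi> \<and> bij \<phi> \<and> (\<forall>u v. g Q (\<phi> u) (\<phi> v) = g P u v)"

definition curvature_homogeneous ::
  "nat \<Rightarrow> ('a, 'e::euclidean_space) manifold \<Rightarrow> ('a \<Rightarrow> 'e \<Rightarrow> 'e \<Rightarrow> real) \<Rightarrow> bool" where
  "curvature_homogeneous k M g \<longleftrightarrow>
     (\<forall>P\<in>points M. \<forall>Q\<in>points M. \<exists>\<phi>. linear_isometry g P Q \<phi> \<and>
        (\<forall>l\<le>k. \<forall>vs. length vs = l + 4 \<longrightarrow>
           nabla_R M g l Q (map \<phi> vs) = nabla_R M g l P vs))"

definition homothety_curvature_homogeneous ::
  "nat \<Rightarrow> ('a, 'e::euclidean_space) manifold \<Rightarrow> ('a \<Rightarrow> 'e \<Rightarrow> 'e \<Rightarrow> real) \<Rightarrow> bool" where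
  "homothety_curvature_homogeneous k M g \<longleftrightarrow>
     (\<forall>P\<in>points M. \<forall>Q\<in>points M. \<exists>\<phi> (s::real). linear_isometry g P Q \<phi> \<and> s \<noteq> 0 \<and>
        (\<forall>l\<le>k. \<forall>vs. length vs = l + 4 \<longrightarrow>
           nabla_R M g l Q (map \<phi> vs) = s powi (- int l - 2) * nabla_R M g l P vs))"


section \<open>Lie groups and the structures under consideration\<close>

locale lie_group = group G + smooth_manifold GM
  for G :: "'b monoid" and GM :: "('b, 'h::euclidean_space) manifold" +
  assumes carrier_points: "points GM = carrier G"
    and mult_smooth: "smooth_map (product_manifold GM GM) GM (\<lambda>(a, b). a \<otimes>\<^bsub>G\<^esub> b)"
    and inverse_smooth: "smooth_map GM GM (\<lambda>a. inv\<^bsub>G\<^esub> a)"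

locale Q_structure =
  lie_group G GM +
  pseudo_riemannian_manifold N gN +
  faithful_action G "points N" act +
  transitive_action G "points N" act
  for N :: "('a, 'e::euclidean_space) manifold"
    and gN :: "'a \<Rightarrow> 'e \<Rightarrow> 'e \<Rightarrow> real"
    and G :: "'b monoid"
    and GM :: "('b, 'h::euclidean_space) manifold"
    and act :: "'b \<Rightarrow> 'a \<Rightarrow> 'a" +
  fixes \<theta> :: "'a \<Rightarrow> 'e \<Rightarrow> real"
  assumes N_connected: "connected_manifold N"
    and G_connected: "connected_manifold GM"
    and action_smooth: "smooth_map (product_manifold GM N) N (\<lambda>(a, p). act a p)"
    and action_isometry: "a \<in> carrier G \<Longrightarrow> isometry N gN (act a)"
    and form_smooth: "smooth_one_form N \<theta>"
    and form_invariant: "a \<in> carrier G \<Longrightarrow> invariant_one_form N (act a) \<theta>"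

text \<open>
  The manifold \<open>\<real> \<times> N\<close> with the metric \<open>e\<^bsup>tx\<^esup>(dx\<^sup>2 + g\<^sub>N)\<close>, where \<open>dx\<close> is the differential of the
  first projection and \<open>g\<^sub>N\<close> is pulled back along the second one.
\<close>

abbreviation M_space :: "('a, 'e) manifold \<Rightarrow> (real \<times> 'a, real \<times> 'e) manifold" where
  "M_space N \<equiv> product_manifold real_line N"

definition M_metric ::
  "real \<Rightarrow> ('a, 'e::euclidean_space) manifold \<Rightarrow> ('a \<Rightarrow> 'e \<Rightarrow> 'e \<Rightarrow> real)
     \<Rightarrow> real \<times> 'a \<Rightarrow> real \<times> 'e \<Rightarrow> real \<times> 'e \<Rightarrow> real" where
  "M_metric t N gN P u v =
     exp (t * fst P) *
       (differential (M_space N) real_line fst P u * differential (M_space N) real_line fst P v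
        + gN (snd P) (differential (M_space N) N snd P u) (differential (M_space N) N snd P v))"

end

theory Submission
  imports Defs
begin

text \<open>
  The map \<open>(x, p) \<mapsto> (x + r, f p)\<close>, for an isometry \<open>f\<close> of \<open>N\<close>, multiplies the metric
  \<open>e\<^bsup>tx\<^esup>(dx\<^sup>2 + g\<^sub>N)\<close> by the constant \<open>e\<^bsup>tr\<^esup>\<close>. It therefore preserves the Levi-Civita connection,
  multiplies each covariant tensor \<open>\<nabla>\<^sup>lR\<close> by \<open>e\<^bsup>tr\<^esup>\<close>, and its differential becomes a linear
  isometry after division by \<open>e\<^bsup>tr/2\<^esup>\<close>; as the isometries of \<open>N\<close> act transitively, this gives
  homothety curvature homogeneity. On the other hand the scalar curvature of the metric is
  \<open>e\<^bsup>-tx\<^esup>(\<tau>\<^sub>N - (m-1)(m-2)t\<^sup>2/4)\<close>, which is not constant, whereas on a \<open>0\<close>-curvature homogeneous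
  manifold it would be. Finally, a flat homothety curvature homogeneous manifold would be
  \<open>0\<close>-curvature homogeneous.
\<close>

section \<open>Calculus of smooth maps\<close>

text \<open>Tangent vectors are components in a preferred chart picked by choice, so nothing on the
  manifold is visibly independent of charts, and the preferred chart of the product at a point may
  be the cylinder over any chart of \<open>N\<close> around it. Both difficulties are met by one
  transformation law, for smooth maps between open sets that multiply the metric by a constant: for
  the identity of \<open>N\<close> it is independence of the chart, for an isometry it is
  invariance, and for an isometry times a translation of the line it is the homothety. The law
  requires smooth Christoffel symbols. These are defined through \<open>sharp\<close>, a definite
  description, so the regularity of raising an index is derived from a fixed point equation around
  each point. The constant in the scalar curvature arises as follows: with n = m - 1, the metric
  changes the curvature of \<open>N\<close> by that of a space of constant sectional curvature
  t^2/4, whose scalar curvature n(n-1)t^2/4 is subtracted, while the direction of the line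
  contributes nothing.\<close>

abbreviation fderiv :: "('e::real_normed_vector \<Rightarrow> 'f::real_normed_vector) \<Rightarrow> 'e \<Rightarrow> 'e \<Rightarrow> 'f" where
  "fderiv f x \<equiv> frechet_derivative f (at x)"

lemma fderivI: "(f has_derivative f') (at x) \<Longrightarrow> fderiv f x = f'"
  by (simp add: frechet_derivative_at[symmetric])

lemma has_fderiv: "f differentiable (at x) \<Longrightarrow> (f has_derivative fderiv f x) (at x)"
  by (simp add: frechet_derivative_works[symmetric])

text \<open>\<open>C_k_on\<close> differentiates along fixed directions only. Wherever a direction
  or an argument varies with the point, this expansion replaces it by scalar coefficients times
  fixed basis vectors.\<close>

lemma linear_expansion:
  fixes f :: "'e::euclidean_space \<Rightarrow> 'f::real_vector"
  assumes "linear f"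
  shows "f w = (\<Sum>b\<in>Basis. (w \<bullet> b) *\<^sub>R f b)"
proof -
  have "f w = f (\<Sum>b\<in>Basis. (w \<bullet> b) *\<^sub>R b)" by (simp add: euclidean_representation)
  also have "\<dots> = (\<Sum>b\<in>Basis. (w \<bullet> b) *\<^sub>R f b)"
    by (simp add: linear_sum[OF assms] linear_cmul[OF assms] o_def)
  finally show ?thesis .
qed

lemma C_k_on_cong:
  assumes "open S" "\<And>x. x \<in> S \<Longrightarrow> f x = g x" "C_k_on k S f"
  shows "C_k_on k S g"
  using assms(2,3)
proof (induction k arbitrary: f g)
  case 0
  then show ?case using continuous_on_cong[of S S f g] by simp
next
  case (Suc k)
  have d: "(g has_derivative fderiv f x) (at x)" if "x \<in> S" for x
    by (rule has_derivative_transform_within_open[OF has_fderiv assms(1) that]) (use Suc.prems that in auto)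
  show ?case
  proof (simp, intro conjI ballI allI)
    show "g differentiable (at x)" if "x \<in> S" for x using d that unfolding differentiable_def by blast
    show "C_k_on k S (\<lambda>x. fderiv g x v)" for v
      by (rule Suc.IH[of "\<lambda>x. fderiv f x v"]) (use Suc.prems(2) in \<open>simp_all add: fderivI[OF d]\<close>)
  qed
qed

lemma C_k_on_Suc_imp: "C_k_on (Suc k) S f \<Longrightarrow> C_k_on k S f"
proof (induction k arbitrary: f)
  case 0
  then show ?case
    by (auto intro!: continuous_at_imp_continuous_on differentiable_imp_continuous_within)
next
  case (Suc k)
  then show ?case using C_k_on.simps(2) by blast
qed

lemma C_k_on_subset: "C_k_on k S f \<Longrightarrow> T \<subseteq> S \<Longrightarrow> C_k_on k T f"
  by (induction k arbitrary: f) (auto intro: continuous_on_subset)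

lemma C_k_on_SucI:
  assumes "open S" "\<And>x. x \<in> S \<Longrightarrow> (f has_derivative f' x) (at x)"
    and "\<And>v. C_k_on k S (\<lambda>x. f' x v)"
  shows "C_k_on (Suc k) S f"
proof (simp, intro conjI ballI allI)
  show "f differentiable (at x)" if "x \<in> S" for x using assms(2)[OF that] unfolding differentiable_def by blast
  show "C_k_on k S (\<lambda>x. fderiv f x v)" for v
    by (rule C_k_on_cong[OF assms(1) _ assms(3)[of v]]) (simp add: fderivI[OF assms(2)])
qed

lemma C_k_on_const: "open S \<Longrightarrow> C_k_on k S (\<lambda>x. c)"
proof (induction k arbitrary: c)
  case (Suc k)
  show ?case by (rule C_k_on_SucI[where f' = "\<lambda>x v. 0"]) (auto simp: Suc)
qed simp

lemma C_k_on_add: "open S \<Longrightarrow> C_k_on k S f \<Longrightarrow> C_k_on k S g \<Longrightarrow> C_k_on k S (\<lambda>x. f x + g x)"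
proof (induction k arbitrary: f g)
  case 0
  then show ?case by (simp add: continuous_on_add)
next
  case (Suc k)
  show ?case
    by (rule C_k_on_SucI[where f' = "\<lambda>x v. fderiv f x v + fderiv g x v"])
      (use Suc in \<open>auto intro!: has_derivative_add has_fderiv\<close>)
qed

lemma C_k_on_sum:
  assumes "open S" "\<And>i. i \<in> I \<Longrightarrow> C_k_on k S (f i)"
  shows "C_k_on k S (\<lambda>x. \<Sum>i\<in>I. f i x)"
proof (cases "finite I")
  case True
  then show ?thesis using assms(2)
    by (induction I rule: finite_induct) (auto intro: C_k_on_const C_k_on_add assms(1))
qed (auto intro: C_k_on_const assms(1))

lemma C_k_on_scaleR:
  fixes f :: "'e::euclidean_space \<Rightarrow> real"
  shows "open S \<Longrightarrow> C_k_on k S f \<Longrightarrow> C_k_on k S g \<Longrightarrow> C_k_on k S (\<lambda>x. f x *\<^sub>R g x)"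
proof (induction k arbitrary: f g)
  case 0
  then show ?case by (simp add: continuous_on_scaleR)
next
  case (Suc k)
  show ?case
  proof (rule C_k_on_SucI[where f' = "\<lambda>x v. f x *\<^sub>R fderiv g x v + fderiv f x v *\<^sub>R g x"])
    show "((\<lambda>x. f x *\<^sub>R g x) has_derivative (\<lambda>v. f x *\<^sub>R fderiv g x v + fderiv f x v *\<^sub>R g x)) (at x)"
      if "x \<in> S" for x using Suc.prems that by (intro has_derivative_scaleR has_fderiv) auto
    show "C_k_on k S (\<lambda>x. f x *\<^sub>R fderiv g x v + fderiv f x v *\<^sub>R g x)" for v
      using Suc.prems C_k_on_Suc_imp[of k S f] C_k_on_Suc_imp[of k S g]
      by (intro C_k_on_add Suc.IH) auto
  qed (fact Suc.prems)
qed

lemma C_k_on_mult: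
  fixes f g :: "'e::euclidean_space \<Rightarrow> real"
  shows "open S \<Longrightarrow> C_k_on k S f \<Longrightarrow> C_k_on k S g \<Longrightarrow> C_k_on k S (\<lambda>x. f x * g x)"
  using C_k_on_scaleR[of S k f g] by simp

lemma C_k_on_bounded_linear:
  assumes "open S" "bounded_linear L" "C_k_on k S f"
  shows "C_k_on k S (\<lambda>x. L (f x))"
  using assms(3)
proof (induction k arbitrary: f)
  case 0
  then show ?case using bounded_linear.continuous_on[OF assms(2)] by simp
next
  case (Suc k)
  show ?case
    by (rule C_k_on_SucI[where f' = "\<lambda>x v. L (fderiv f x v)"])
      (use Suc assms in \<open>auto intro!: bounded_linear.has_derivative[OF assms(2)] has_fderiv\<close>)
qed

lemma C_k_on_linear:
  fixes L :: "'e::euclidean_space \<Rightarrow> 'f::real_normed_vector"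
  assumes "open S" "linear L"
  shows "C_k_on k S L"
proof (cases k)
  case 0
  then show ?thesis using assms linear_continuous_on linear_conv_bounded_linear by auto
next
  case (Suc k')
  have "(L has_derivative L) (at x)" for x
    using assms(2) by (simp add: linear_conv_bounded_linear bounded_linear_imp_has_derivative)
  then show ?thesis unfolding Suc
    by (intro C_k_on_SucI[where f' = "\<lambda>x. L"]) (auto intro: C_k_on_const assms)
qed

lemma C_k_on_compose:
  fixes f :: "'f::euclidean_space \<Rightarrow> 'g::real_normed_vector" and F :: "'e::euclidean_space \<Rightarrow> 'f"
  assumes "open S" "open T" "\<And>x. x \<in> S \<Longrightarrow> F x \<in> T" "C_k_on k T f" "C_k_on k S F"
  shows "C_k_on k S (\<lambda>x. f (F x))"
  using assms(4,5)
proof (induction k arbitrary: f)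
  case 0
  then show ?case using continuous_on_compose2[of T f S F] assms(3) by auto
next
  case (Suc k)
  show ?case
  \<comment> \<open>The direction \<open>fderiv F x v\<close> moves with \<open>x\<close>, so the
    chain rule is expanded in the basis: each \<open>fderiv f (F x) b\<close> is again a composition
    with \<open>F\<close>, to which the induction hypothesis applies.\<close>
  proof (rule C_k_on_SucI[where f' = "\<lambda>x v. \<Sum>b\<in>Basis. (fderiv F x v \<bullet> b) *\<^sub>R fderiv f (F x) b"])
    show "((\<lambda>x. f (F x)) has_derivative (\<lambda>v. \<Sum>b\<in>Basis. (fderiv F x v \<bullet> b) *\<^sub>R fderiv f (F x) b)) (at x)"
      if "x \<in> S" for x
    proof -
      have f: "f differentiable (at (F x))" and F: "F differentiable (at x)"
        using Suc.prems that assms(3) by auto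
      have "((\<lambda>x. f (F x)) has_derivative (\<lambda>v. fderiv f (F x) (fderiv F x v))) (at x)"
        using diff_chain_at[OF has_fderiv[OF F] has_fderiv[OF f]] by (simp add: o_def)
      moreover have "(\<lambda>v. fderiv f (F x) (fderiv F x v)) =
          (\<lambda>v. \<Sum>b\<in>Basis. (fderiv F x v \<bullet> b) *\<^sub>R fderiv f (F x) b)"
        by (intro ext linear_expansion linear_frechet_derivative f)
      ultimately show ?thesis by simp
    qed
    have "C_k_on k S (\<lambda>x. fderiv F x v \<bullet> b)" for v b
      using Suc.prems by (intro C_k_on_bounded_linear[OF assms(1) bounded_linear_inner_left]) auto
    then show "C_k_on k S (\<lambda>x. \<Sum>b\<in>Basis. (fderiv F x v \<bullet> b) *\<^sub>R fderiv f (F x) b)" for v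
      using Suc.prems C_k_on_Suc_imp[of k S F]
      by (intro C_k_on_sum C_k_on_scaleR Suc.IH assms(1)) auto
  qed (fact assms(1))
qed

lemma smooth_onD: "smooth_on S f \<Longrightarrow> C_k_on k S f"
  by (simp add: smooth_on_def)

lemma smooth_on_differentiable: "smooth_on S f \<Longrightarrow> x \<in> S \<Longrightarrow> f differentiable (at x)"
  using smooth_onD[of S f "Suc 0"] by simp

lemma smooth_on_fderiv: "smooth_on S f \<Longrightarrow> smooth_on S (\<lambda>x. fderiv f x v)"
  unfolding smooth_on_def using C_k_on.simps(2) by blast

lemma smooth_on_subset: "smooth_on S f \<Longrightarrow> T \<subseteq> S \<Longrightarrow> smooth_on T f"
  unfolding smooth_on_def using C_k_on_subset by blast

lemma smooth_on_cong:
  "open S \<Longrightarrow> (\<And>x. x \<in> S \<Longrightarrow> f x = g x) \<Longrightarrow> smooth_on S f \<Longrightarrow> smooth_on S g"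
  unfolding smooth_on_def using C_k_on_cong by blast

lemma smooth_on_const: "open S \<Longrightarrow> smooth_on S (\<lambda>x. c)"
  unfolding smooth_on_def using C_k_on_const by blast

lemma smooth_on_add: "open S \<Longrightarrow> smooth_on S f \<Longrightarrow> smooth_on S g \<Longrightarrow> smooth_on S (\<lambda>x. f x + g x)"
  unfolding smooth_on_def using C_k_on_add by blast

lemma smooth_on_sum:
  "open S \<Longrightarrow> (\<And>i. i \<in> I \<Longrightarrow> smooth_on S (f i)) \<Longrightarrow> smooth_on S (\<lambda>x. \<Sum>i\<in>I. f i x)"
  unfolding smooth_on_def by (simp add: C_k_on_sum)

lemma smooth_on_scaleR:
  fixes f :: "'e::euclidean_space \<Rightarrow> real"
  shows "open S \<Longrightarrow> smooth_on S f \<Longrightarrow> smooth_on S g \<Longrightarrow> smooth_on S (\<lambda>x. f x *\<^sub>R g x)"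
  unfolding smooth_on_def using C_k_on_scaleR by blast

lemma smooth_on_mult:
  fixes f g :: "'e::euclidean_space \<Rightarrow> real"
  shows "open S \<Longrightarrow> smooth_on S f \<Longrightarrow> smooth_on S g \<Longrightarrow> smooth_on S (\<lambda>x. f x * g x)"
  unfolding smooth_on_def using C_k_on_mult by blast

lemma smooth_on_bounded_linear:
  "open S \<Longrightarrow> bounded_linear L \<Longrightarrow> smooth_on S f \<Longrightarrow> smooth_on S (\<lambda>x. L (f x))"
  unfolding smooth_on_def using C_k_on_bounded_linear by blast

lemma smooth_on_linear:
  fixes L :: "'e::euclidean_space \<Rightarrow> 'f::real_normed_vector"
  shows "open S \<Longrightarrow> linear L \<Longrightarrow> smooth_on S L"
  unfolding smooth_on_def using C_k_on_linear by blast

lemma smooth_on_diff: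
  "open S \<Longrightarrow> smooth_on S f \<Longrightarrow> smooth_on S g \<Longrightarrow> smooth_on S (\<lambda>x. f x - g x)"
  using smooth_on_add[of S f "\<lambda>x. - g x"]
    smooth_on_bounded_linear[OF _ bounded_linear_minus[OF bounded_linear_ident]] by fastforce

lemma smooth_on_compose:
  fixes f :: "'f::euclidean_space \<Rightarrow> 'g::real_normed_vector" and F :: "'e::euclidean_space \<Rightarrow> 'f"
  shows "open S \<Longrightarrow> open T \<Longrightarrow> (\<And>x. x \<in> S \<Longrightarrow> F x \<in> T) \<Longrightarrow> smooth_on T f \<Longrightarrow> smooth_on S F \<Longrightarrow>
    smooth_on S (\<lambda>x. f (F x))"
  unfolding smooth_on_def using C_k_on_compose[of S T F] by blast

lemma smooth_on_Pair:
  assumes "open S" "smooth_on S f" "smooth_on S g"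
  shows "smooth_on S (\<lambda>x. (f x, g x))"
proof -
  have "smooth_on S (\<lambda>x. (f x, 0))" "smooth_on S (\<lambda>x. (0, g x))"
    using smooth_on_bounded_linear[OF assms(1) bounded_linear_Pair[OF bounded_linear_ident bounded_linear_zero] assms(2)]
      smooth_on_bounded_linear[OF assms(1) bounded_linear_Pair[OF bounded_linear_zero bounded_linear_ident] assms(3)]
    by auto
  from smooth_on_add[OF assms(1) this] show ?thesis by simp
qed

text \<open>For inserting a varying vector, such as a Christoffel symbol, into one slot of a smooth
  tensor.\<close>

lemma smooth_on_linear_apply:
  fixes B :: "'e::euclidean_space \<Rightarrow> 'f::euclidean_space \<Rightarrow> 'g::real_normed_vector"
  assumes "open S" "\<And>y. y \<in> S \<Longrightarrow> linear (B y)" "\<And>b. smooth_on S (\<lambda>y. B y b)" "smooth_on S W"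
  shows "smooth_on S (\<lambda>y. B y (W y))"
proof (rule smooth_on_cong[OF assms(1)])
  show "smooth_on S (\<lambda>y. \<Sum>b\<in>Basis. (W y \<bullet> b) *\<^sub>R B y b)"
    by (intro smooth_on_sum smooth_on_scaleR smooth_on_bounded_linear[OF assms(1) bounded_linear_inner_left] assms)
qed (simp add: linear_expansion[OF assms(2), symmetric])

text \<open>Linearity in \<open>z\<close> holds at every point of the open set \<open>S\<close>, so
  it survives differentiation in the base point.\<close>

lemma linear_fderiv_family:
  fixes B :: "'e::euclidean_space \<Rightarrow> 'f::real_vector \<Rightarrow> 'g::real_normed_vector"
  assumes S: "open S" "y \<in> S" and lin: "\<And>x. x \<in> S \<Longrightarrow> linear (B x)"
    and diff: "\<And>z. (\<lambda>x. B x z) differentiable (at y)"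
  shows "linear (\<lambda>z. fderiv (\<lambda>x. B x z) y u)"
proof (rule linearI)
  fix a b :: 'f and r :: real
  have "((\<lambda>x. B x (a + b)) has_derivative (\<lambda>u. fderiv (\<lambda>x. B x a) y u + fderiv (\<lambda>x. B x b) y u)) (at y)"
    by (rule has_derivative_transform_within_open[OF has_derivative_add[OF has_fderiv has_fderiv] S])
      (use diff lin in \<open>auto simp: linear_add\<close>)
  from fderivI[OF this] show "fderiv (\<lambda>x. B x (a + b)) y u = fderiv (\<lambda>x. B x a) y u + fderiv (\<lambda>x. B x b) y u"
    by simp
  have "((\<lambda>x. B x (r *\<^sub>R b)) has_derivative (\<lambda>u. r *\<^sub>R fderiv (\<lambda>x. B x b) y u)) (at y)"
    by (rule has_derivative_transform_within_open[OF has_derivative_scaleR_right[OF has_fderiv] S])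
      (use diff lin in \<open>auto simp: linear_cmul\<close>)
  from fderivI[OF this] show "fderiv (\<lambda>x. B x (r *\<^sub>R b)) y u = r *\<^sub>R fderiv (\<lambda>x. B x b) y u"
    by simp
qed

text \<open>Both sides choose from the same set of derivatives, so the equation also covers points
  where no derivative exists and the choice is arbitrary.\<close>

lemma fderiv_cong:
  assumes "open S" "y \<in> S" "\<And>x. x \<in> S \<Longrightarrow> f x = g x"
  shows "fderiv f y = fderiv g y"
proof -
  have "(f has_derivative f') (at y) \<longleftrightarrow> (g has_derivative f') (at y)" for f'
    using has_derivative_transform_within_open[OF _ assms(1,2)] assms(3) by metis
  then show ?thesis unfolding frechet_derivative_def by simp
qed

section \<open>Symmetry of second derivatives\<close>

lemma second_difference_mean_value:
  fixes f :: "'e::euclidean_space \<Rightarrow> real"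
  assumes f: "C_k_on (Suc (Suc 0)) S f" and s: "s > 0"
    and S: "\<And>a b. 0 \<le> a \<Longrightarrow> a \<le> s \<Longrightarrow> 0 \<le> b \<Longrightarrow> b \<le> s \<Longrightarrow> x + a *\<^sub>R u + b *\<^sub>R v \<in> S"
  shows "\<exists>a b. 0 \<le> a \<and> a \<le> s \<and> 0 \<le> b \<and> b \<le> s \<and>
    f (x + s *\<^sub>R u + s *\<^sub>R v) - f (x + s *\<^sub>R u) - f (x + s *\<^sub>R v) + f x =
    s * s * fderiv (\<lambda>x. fderiv f x u) (x + a *\<^sub>R u + b *\<^sub>R v) v"
proof -
  have line: "((\<lambda>r. p + r *\<^sub>R w) has_derivative (\<lambda>h. h *\<^sub>R w)) (at r)" for p w :: 'e and r
    by (auto intro!: derivative_eq_intros)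
  have der: "((\<lambda>r. h (p + r *\<^sub>R w)) has_derivative (\<lambda>k. k * fderiv h (p + r *\<^sub>R w) w)) (at r)"
    if "h differentiable (at (p + r *\<^sub>R w))" for h :: "'e \<Rightarrow> real" and p w r
    using diff_chain_at[OF line has_fderiv[OF that]]
      linear_cmul[OF linear_frechet_derivative[OF that]] by (simp add: o_def)
  have df: "f differentiable (at p)" "(\<lambda>x. fderiv f x u) differentiable (at p)" if "p \<in> S" for p
    using f that by auto
  \<comment> \<open>The second difference is the increment over \<open>[0, s]\<close> of a first
    difference in the direction \<open>v\<close>; the mean value theorem is applied along
    \<open>u\<close> to it, and then along \<open>v\<close> to the derivative in the direction
    \<open>u\<close>.\<close>
  let ?\<phi> = "\<lambda>r. f (x + s *\<^sub>R v + r *\<^sub>R u) - f (x + r *\<^sub>R u)"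
  have "\<exists>a\<in>{0<..<s}. ?\<phi> s - ?\<phi> 0 =
      (\<lambda>k. k * fderiv f (x + s *\<^sub>R v + a *\<^sub>R u) u - k * fderiv f (x + a *\<^sub>R u) u) (s - 0)"
  proof (rule mvt_simple[OF s])
    fix r assume r: "0 \<le> r" "r \<le> s"
    have "x + s *\<^sub>R v + r *\<^sub>R u \<in> S" "x + r *\<^sub>R u \<in> S"
      using S[OF r, of s] S[OF r, of 0] s by (auto simp: algebra_simps)
    from has_derivative_diff[OF der[OF df(1)[OF this(1)]] der[OF df(1)[OF this(2)]]]
    show "(?\<phi> has_derivative
        (\<lambda>k. k * fderiv f (x + s *\<^sub>R v + r *\<^sub>R u) u - k * fderiv f (x + r *\<^sub>R u) u)) (at r within {0..s})"
      by (rule has_derivative_at_withinI)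
  qed
  then obtain a where a: "0 < a" "a < s"
    and 1: "?\<phi> s - ?\<phi> 0 = s * (fderiv f (x + s *\<^sub>R v + a *\<^sub>R u) u - fderiv f (x + a *\<^sub>R u) u)"
    by (auto simp: algebra_simps)
  let ?\<psi> = "\<lambda>r. fderiv f (x + a *\<^sub>R u + r *\<^sub>R v) u"
  have "\<exists>b\<in>{0<..<s}. ?\<psi> s - ?\<psi> 0 =
      (\<lambda>k. k * fderiv (\<lambda>x. fderiv f x u) (x + a *\<^sub>R u + b *\<^sub>R v) v) (s - 0)"
  proof (rule mvt_simple[OF s])
    fix r assume "0 \<le> r" "r \<le> s"
    then have "x + a *\<^sub>R u + r *\<^sub>R v \<in> S" using S a by simp
    from der[OF df(2)[OF this]]
    show "(?\<psi> has_derivative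
        (\<lambda>k. k * fderiv (\<lambda>x. fderiv f x u) (x + a *\<^sub>R u + r *\<^sub>R v) v)) (at r within {0..s})"
      by (rule has_derivative_at_withinI)
  qed
  then obtain b where b: "0 < b" "b < s"
    and 2: "?\<psi> s - ?\<psi> 0 = s * fderiv (\<lambda>x. fderiv f x u) (x + a *\<^sub>R u + b *\<^sub>R v) v"
    by auto
  have "f (x + s *\<^sub>R u + s *\<^sub>R v) - f (x + s *\<^sub>R u) - f (x + s *\<^sub>R v) + f x = ?\<phi> s - ?\<phi> 0"
    by (simp add: algebra_simps)
  also have "\<dots> = s * (?\<psi> s - ?\<psi> 0)" using 1 by (simp add: algebra_simps)
  finally show ?thesis using 2 a b by (intro exI[of _ a] exI[of _ b]) auto
qed

text \<open>The quotient is a value of the mixed derivative somewhere in a small parallelogram at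
  \<open>x\<close>, and that derivative is continuous.\<close>

lemma second_derivative_limit:
  fixes f :: "'e::euclidean_space \<Rightarrow> real"
  assumes f: "C_k_on (Suc (Suc 0)) S f" and S: "open S" "x \<in> S" and e: "e > 0"
  shows "\<exists>d>0. \<forall>s. 0 < s \<and> s < d \<longrightarrow>
    \<bar>(f (x + s *\<^sub>R u + s *\<^sub>R v) - f (x + s *\<^sub>R u) - f (x + s *\<^sub>R v) + f x) / (s * s) -
      fderiv (\<lambda>x. fderiv f x u) x v\<bar> < e"
proof -
  let ?H = "\<lambda>x. fderiv (\<lambda>x. fderiv f x u) x v"
  have "continuous_on S ?H" using f by simp
  then obtain d1 where d1: "d1 > 0" "\<And>z. z \<in> S \<Longrightarrow> dist z x < d1 \<Longrightarrow> dist (?H z) (?H x) < e"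
    using S(2) e unfolding continuous_on_iff by blast
  obtain d2 where d2: "d2 > 0" "ball x d2 \<subseteq> S" using S open_contains_ball by blast
  \<comment> \<open>For \<open>s < d\<close> the parallelogram spanned by
    \<open>s *\<^sub>R u\<close> and \<open>s *\<^sub>R v\<close> stays within
    \<open>min d1 d2\<close> of \<open>x\<close>; the \<open>+ 1\<close> keeps the denominator
    positive when \<open>u\<close> and \<open>v\<close> vanish.\<close>
  define d where "d = min d1 d2 / (norm u + norm v + 1)"
  have n: "norm u + norm v + 1 > 0" by (simp add: add_nonneg_pos)
  have d: "d > 0" unfolding d_def using d1(1) d2(1) n by simp
  have near: "dist (x + a *\<^sub>R u + b *\<^sub>R v) x < min d1 d2"
    if "s < d" "0 \<le> a" "a \<le> s" "0 \<le> b" "b \<le> s" for a b s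
  proof -
    have "norm (a *\<^sub>R u + b *\<^sub>R v) \<le> a * norm u + b * norm v"
      using that norm_triangle_ineq[of "a *\<^sub>R u" "b *\<^sub>R v"] by simp
    also have "\<dots> \<le> s * norm u + s * norm v"
      using that by (intro add_mono mult_right_mono) auto
    also have "\<dots> \<le> s * (norm u + norm v + 1)" using that by (simp add: algebra_simps)
    also have "\<dots> < d * (norm u + norm v + 1)" using that n by (intro mult_strict_right_mono) auto
    also have "\<dots> = min d1 d2" unfolding d_def using n by simp
    finally show ?thesis by (simp add: dist_norm algebra_simps)
  qed
  show ?thesis
  proof (intro exI conjI allI impI, rule d)
    fix s assume s: "0 < s \<and> s < d"
    have inS: "x + a *\<^sub>R u + b *\<^sub>R v \<in> S" if "0 \<le> a" "a \<le> s" "0 \<le> b" "b \<le> s" for a b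
      using near[of s a b] s that d2(2) by (auto simp: dist_commute subset_iff)
    obtain a b where ab: "0 \<le> a" "a \<le> s" "0 \<le> b" "b \<le> s"
      and eq: "f (x + s *\<^sub>R u + s *\<^sub>R v) - f (x + s *\<^sub>R u) - f (x + s *\<^sub>R v) + f x =
        s * s * ?H (x + a *\<^sub>R u + b *\<^sub>R v)"
      using second_difference_mean_value[OF f, of s x u v] s inS by blast
    have "dist (?H (x + a *\<^sub>R u + b *\<^sub>R v)) (?H x) < e"
      using near[of s a b] ab s inS by (intro d1(2)) auto
    then show "\<bar>(f (x + s *\<^sub>R u + s *\<^sub>R v) - f (x + s *\<^sub>R u) - f (x + s *\<^sub>R v) + f x) / (s * s) - ?H x\<bar> < e"
      unfolding eq using s by (simp add: dist_real_def)
  qed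
qed

text \<open>The second difference is symmetric in \<open>u\<close> and \<open>v\<close>, so both
  mixed derivatives are limits of the same quotients.\<close>

lemma second_derivative_symmetric_real:
  fixes f :: "'e::euclidean_space \<Rightarrow> real"
  assumes f: "C_k_on (Suc (Suc 0)) S f" and S: "open S" "x \<in> S"
  shows "fderiv (\<lambda>x. fderiv f x u) x v = fderiv (\<lambda>x. fderiv f x v) x u" (is "?A = ?B")
proof (rule ccontr)
  assume "?A \<noteq> ?B"
  define e where "e = \<bar>?A - ?B\<bar> / 2"
  have e: "e > 0" using \<open>?A \<noteq> ?B\<close> by (simp add: e_def)
  obtain d1 where d1: "d1 > 0" "\<And>s. 0 < s \<and> s < d1 \<Longrightarrow>
    \<bar>(f (x + s *\<^sub>R u + s *\<^sub>R v) - f (x + s *\<^sub>R u) - f (x + s *\<^sub>R v) + f x) / (s * s) - ?A\<bar> < e"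
    using second_derivative_limit[OF f S e, of u v] by blast
  obtain d2 where d2: "d2 > 0" "\<And>s. 0 < s \<and> s < d2 \<Longrightarrow>
    \<bar>(f (x + s *\<^sub>R v + s *\<^sub>R u) - f (x + s *\<^sub>R v) - f (x + s *\<^sub>R u) + f x) / (s * s) - ?B\<bar> < e"
    using second_derivative_limit[OF f S e, of v u] by blast
  define s where "s = min d1 d2 / 2"
  have s: "0 < s \<and> s < d1" "0 < s \<and> s < d2" using d1(1) d2(1) by (auto simp: s_def)
  have eq: "f (x + s *\<^sub>R v + s *\<^sub>R u) - f (x + s *\<^sub>R v) - f (x + s *\<^sub>R u) + f x =
    f (x + s *\<^sub>R u + s *\<^sub>R v) - f (x + s *\<^sub>R u) - f (x + s *\<^sub>R v) + f x"
    by (simp add: algebra_simps)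
  \<comment> \<open>No real \<open>q\<close> lies within less than half the distance between
    \<open>p\<close> and \<open>r\<close> from both of them.\<close>
  have apart: "\<not> (\<bar>q - p\<bar> < \<bar>p - r\<bar> / 2 \<and> \<bar>q - r\<bar> < \<bar>p - r\<bar> / 2)" for p q r :: real
    by (auto simp: abs_if split: if_splits)
  show False using d1(2)[OF s(1)] d2(2)[OF s(2)] apart unfolding eq e_def by blast
qed

text \<open>Reduced to the real case coordinate by coordinate, as the mean value theorem behind it
  is one for real functions.\<close>

lemma second_derivative_symmetric:
  fixes f :: "'e::euclidean_space \<Rightarrow> 'f::euclidean_space"
  assumes f: "smooth_on S f" and S: "open S" "x \<in> S"
  shows "fderiv (\<lambda>x. fderiv f x u) x v = fderiv (\<lambda>x. fderiv f x v) x u"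
proof (rule euclidean_eqI)
  fix b :: 'f assume "b \<in> Basis"
  have comp: "fderiv (\<lambda>x. h x \<bullet> b) y = (\<lambda>w. fderiv h y w \<bullet> b)" if "h differentiable (at y)" for h :: "'e \<Rightarrow> 'f" and y
    using that by (intro fderivI) (auto intro!: derivative_eq_intros has_fderiv)
  have sb: "smooth_on S (\<lambda>x. f x \<bullet> b)"
    by (rule smooth_on_bounded_linear[OF S(1) bounded_linear_inner_left f])
  have second: "fderiv (\<lambda>x. fderiv (\<lambda>x. f x \<bullet> b) x p) x q = fderiv (\<lambda>x. fderiv f x p) x q \<bullet> b" for p q
  proof -
    have "fderiv (\<lambda>x. fderiv (\<lambda>x. f x \<bullet> b) x p) x = fderiv (\<lambda>x. fderiv f x p \<bullet> b) x"
      by (rule fderiv_cong[OF S]) (simp add: comp smooth_on_differentiable[OF f])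
    then show ?thesis
      using smooth_on_differentiable[OF smooth_on_fderiv[OF f] S(2)] by (simp add: comp)
  qed
  show "fderiv (\<lambda>x. fderiv f x u) x v \<bullet> b = fderiv (\<lambda>x. fderiv f x v) x u \<bullet> b"
    using second_derivative_symmetric_real[OF smooth_onD[OF sb] S, of u v] unfolding second .
qed

text \<open>Where \<open>\<phi>\<close> vanishes, the variation of \<open>\<psi>\<close> contributes
  only o(|h|), so continuity of \<open>\<psi>\<close> suffices. This serves to differentiate the
  representer of a linear form, whose own differentiability is still to be shown.\<close>

lemma has_derivative_scaleR_vanishing:
  fixes \<phi> :: "'e::real_normed_vector \<Rightarrow> 'f::real_normed_vector" and \<psi> :: "'e \<Rightarrow> real"
  assumes \<phi>: "(\<phi> has_derivative \<phi>') (at y)" "\<phi> y = 0" and \<psi>: "isCont \<psi> y"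
  shows "((\<lambda>x. \<psi> x *\<^sub>R \<phi> x) has_derivative (\<lambda>h. \<psi> y *\<^sub>R \<phi>' h)) (at y)"
proof -
  interpret bounded_linear \<phi>' using has_derivative_bounded_linear[OF \<phi>(1)] .
  obtain K where K: "\<And>h. norm (\<phi>' h) \<le> norm h * K" using bounded by blast
  have r: "(\<lambda>h. norm (\<phi> (y + h) - \<phi> y - \<phi>' h) / norm h) \<midarrow>0\<rightarrow> 0"
    using \<phi>(1) by (simp add: has_derivative_at)
  have c: "((\<lambda>h. \<psi> (y + h)) \<longlongrightarrow> \<psi> y) (at 0)" using \<psi> by (simp add: isCont_iff)
  have l: "((\<lambda>h. \<bar>\<psi> (y + h)\<bar> * (norm (\<phi> (y + h) - \<phi> y - \<phi>' h) / norm h)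
      + \<bar>\<psi> (y + h) - \<psi> y\<bar> * K) \<longlongrightarrow> \<bar>\<psi> y\<bar> * 0 + \<bar>\<psi> y - \<psi> y\<bar> * K) (at 0)"
    by (intro tendsto_intros r c)
  have "(\<lambda>h. norm (\<psi> (y + h) *\<^sub>R \<phi> (y + h) - \<psi> y *\<^sub>R \<phi> y - \<psi> y *\<^sub>R \<phi>' h) / norm h) \<midarrow>0\<rightarrow> 0"
  proof (rule Lim_null_comparison)
    show "((\<lambda>h. \<bar>\<psi> (y + h)\<bar> * (norm (\<phi> (y + h) - \<phi> y - \<phi>' h) / norm h)
      + \<bar>\<psi> (y + h) - \<psi> y\<bar> * K) \<longlongrightarrow> 0) (at 0)" using l by simp
    show "\<forall>\<^sub>F h in at 0. norm (norm (\<psi> (y + h) *\<^sub>R \<phi> (y + h) - \<psi> y *\<^sub>R \<phi> y - \<psi> y *\<^sub>R \<phi>' h) / norm h)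
      \<le> \<bar>\<psi> (y + h)\<bar> * (norm (\<phi> (y + h) - \<phi> y - \<phi>' h) / norm h) + \<bar>\<psi> (y + h) - \<psi> y\<bar> * K"
    proof (rule eventually_at_topological[THEN iffD2], intro exI[of _ UNIV] conjI ballI impI)
      fix h :: 'e assume "h \<noteq> 0"
      have "\<psi> (y + h) *\<^sub>R \<phi> (y + h) - \<psi> y *\<^sub>R \<phi> y - \<psi> y *\<^sub>R \<phi>' h =
        \<psi> (y + h) *\<^sub>R (\<phi> (y + h) - \<phi> y - \<phi>' h) + (\<psi> (y + h) - \<psi> y) *\<^sub>R \<phi>' h"
        by (simp add: \<phi>(2) algebra_simps)
      then have "norm (\<psi> (y + h) *\<^sub>R \<phi> (y + h) - \<psi> y *\<^sub>R \<phi> y - \<psi> y *\<^sub>R \<phi>' h) \<le>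
        \<bar>\<psi> (y + h)\<bar> * norm (\<phi> (y + h) - \<phi> y - \<phi>' h) + \<bar>\<psi> (y + h) - \<psi> y\<bar> * norm (\<phi>' h)"
        by (metis norm_scaleR norm_triangle_ineq)
      also have "\<dots> \<le> \<bar>\<psi> (y + h)\<bar> * norm (\<phi> (y + h) - \<phi> y - \<phi>' h) + \<bar>\<psi> (y + h) - \<psi> y\<bar> * (norm h * K)"
        by (intro add_left_mono mult_left_mono K) auto
      finally show "norm (norm (\<psi> (y + h) *\<^sub>R \<phi> (y + h) - \<psi> y *\<^sub>R \<phi> y - \<psi> y *\<^sub>R \<phi>' h) / norm h)
      \<le> \<bar>\<psi> (y + h)\<bar> * (norm (\<phi> (y + h) - \<phi> y - \<phi>' h) / norm h) + \<bar>\<psi> (y + h) - \<psi> y\<bar> * K"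
        using \<open>h \<noteq> 0\<close> by (simp add: field_simps)
    qed auto
  qed
  moreover have "bounded_linear (\<lambda>h. \<psi> y *\<^sub>R \<phi>' h)"
    by (rule bounded_linear_const_scaleR[OF has_derivative_bounded_linear[OF \<phi>(1)]])
  ultimately show ?thesis by (simp add: has_derivative_at)
qed

text \<open>Expanding \<open>W x\<close> in the basis leaves products of a scalar function and a
  family with fixed argument; linearity reassembles the two resulting sums.\<close>

lemma has_derivative_linear_apply:
  fixes B :: "'e::euclidean_space \<Rightarrow> 'f::euclidean_space \<Rightarrow> 'g::real_normed_vector"
  assumes S: "open S" "y \<in> S" and lin: "\<And>x. x \<in> S \<Longrightarrow> linear (B x)"
    and diff: "\<And>b. (\<lambda>x. B x b) differentiable (at y)" and W: "(W has_derivative W') (at y)"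
  shows "((\<lambda>x. B x (W x)) has_derivative (\<lambda>u. fderiv (\<lambda>x. B x (W y)) y u + B y (W' u))) (at y)"
proof (rule has_derivative_transform_within_open[OF _ S])
  have "fderiv (\<lambda>x. B x (W y)) y u + B y (W' u) =
      (\<Sum>b\<in>Basis. (W y \<bullet> b) *\<^sub>R fderiv (\<lambda>x. B x b) y u + (W' u \<bullet> b) *\<^sub>R B y b)" for u
    unfolding sum.distrib linear_expansion[OF lin[OF S(2)], of "W' u"]
    by (subst linear_expansion[OF linear_fderiv_family[OF S lin diff], of "W y"]) auto
  moreover have "((\<lambda>x. \<Sum>b\<in>Basis. (W x \<bullet> b) *\<^sub>R B x b) has_derivative
      (\<lambda>u. \<Sum>b\<in>Basis. (W y \<bullet> b) *\<^sub>R fderiv (\<lambda>x. B x b) y u + (W' u \<bullet> b) *\<^sub>R B y b)) (at y)"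
    by (intro has_derivative_sum has_derivative_scaleR has_fderiv[OF diff]
        bounded_linear.has_derivative[OF bounded_linear_inner_left W])
  ultimately show "((\<lambda>x. \<Sum>b\<in>Basis. (W x \<bullet> b) *\<^sub>R B x b) has_derivative
      (\<lambda>u. fderiv (\<lambda>x. B x (W y)) y u + B y (W' u))) (at y)" by simp
  show "(\<Sum>b\<in>Basis. (W x \<bullet> b) *\<^sub>R B x b) = B x (W x)" if "x \<in> S" for x
    using linear_expansion[OF lin[OF that], of "W x"] by simp
qed

section \<open>Tensor fields\<close>

text \<open>Slots are addressed by list update because \<open>covariant_derivative\<close> inserts
  Christoffel symbols in that way.\<close>

definition multilinear :: "nat \<Rightarrow> ('e::real_vector list \<Rightarrow> 'f::real_vector) \<Rightarrow> bool" where
  "multilinear n T \<longleftrightarrow> (\<forall>vs i. length vs = n \<longrightarrow> i < n \<longrightarrow> linear (\<lambda>w. T (vs[i := w])))"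

definition tensor_field ::
  "'e::euclidean_space set \<Rightarrow> nat \<Rightarrow> ('e \<Rightarrow> 'e list \<Rightarrow> 'f::real_normed_vector) \<Rightarrow> bool" where
  "tensor_field S n T \<longleftrightarrow>
     (\<forall>y\<in>S. multilinear n (T y)) \<and> (\<forall>vs. length vs = n \<longrightarrow> smooth_on S (\<lambda>y. T y vs))"

lemma multilinear_update:
  "multilinear n T \<Longrightarrow> length vs = n \<Longrightarrow> i < n \<Longrightarrow> linear (\<lambda>w. T (vs[i := w]))"
  by (simp add: multilinear_def)

lemma multilinear_Cons:
  fixes T :: "'a::real_vector list \<Rightarrow> 'b::real_vector"
  shows "multilinear (Suc n) T \<Longrightarrow> multilinear n (\<lambda>vs. T (b # vs))"
  unfolding multilinear_def
proof (intro allI impI)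
  fix vs :: "'a list" and i
  assume *: "\<forall>vs i. length vs = Suc n \<longrightarrow> i < Suc n \<longrightarrow> linear (\<lambda>w. T (vs[i := w]))" "length vs = n" "i < n"
  show "linear (\<lambda>w. T (b # vs[i := w]))"
    using *(1)[rule_format, of "b # vs" "Suc i"] *(2,3) by simp
qed

text \<open>Leibniz rule for a tensor along \<open>F\<close> evaluated on vector fields
  \<open>fs\<close>. The first slot is split off and treated by
  \<open>has_derivative_linear_apply\<close>; the induction hypothesis handles the tensor whose
  first argument is frozen.\<close>

lemma has_derivative_tensor:
  fixes T :: "'e::euclidean_space \<Rightarrow> 'e list \<Rightarrow> 'f::real_normed_vector" and F :: "'d::euclidean_space \<Rightarrow> 'e"
  assumes U: "open U" "y \<in> U" "F ` U \<subseteq> S" and F: "(F has_derivative F') (at y)"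
  shows "(\<And>x. x \<in> S \<Longrightarrow> multilinear n (T x)) \<Longrightarrow>
    (\<And>vs. length vs = n \<Longrightarrow> (\<lambda>x. T x vs) differentiable (at (F y))) \<Longrightarrow>
    length fs = n \<Longrightarrow> (\<And>f. f \<in> set fs \<Longrightarrow> f differentiable (at y)) \<Longrightarrow>
    ((\<lambda>x. T (F x) (map (\<lambda>f. f x) fs)) has_derivative
      (\<lambda>u. fderiv (\<lambda>x. T x (map (\<lambda>f. f y) fs)) (F y) (F' u)
        + (\<Sum>i<n. T (F y) ((map (\<lambda>f. f y) fs)[i := fderiv (fs ! i) y u])))) (at y)"
proof (induction n arbitrary: T fs)
  case 0
  from 0(2)[of "[]"] 0(3) show ?case
    using diff_chain_at[OF F has_fderiv, of "\<lambda>x. T x []"] by (simp add: o_def)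
next
  case (Suc n)
  obtain f fs' where fs: "fs = f # fs'" and len: "length fs' = n" using Suc.prems(3) by (cases fs) auto
  let ?V = "map (\<lambda>f. f y) fs'"
  define B where "B = (\<lambda>x w. T (F x) (w # map (\<lambda>f. f x) fs'))"
  have derB: "((\<lambda>x. B x w) has_derivative
      (\<lambda>u. fderiv (\<lambda>x. T x (w # ?V)) (F y) (F' u) + (\<Sum>i<n. T (F y) (w # ?V[i := fderiv (fs' ! i) y u]))))
      (at y)" for w
    unfolding B_def
    by (rule Suc.IH[of "\<lambda>x vs. T x (w # vs)"]) (use Suc.prems len fs in \<open>auto intro: multilinear_Cons\<close>)
  \<comment> \<open>The entry \<open>undefined\<close> is a placeholder: slot 0 is overwritten by
    the update.\<close>
  have linB: "linear (B x)" if "x \<in> U" for x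
    using multilinear_update[OF Suc.prems(1), of "F x" "undefined # map (\<lambda>f. f x) fs'" 0] that U(3) len
    by (auto simp: B_def)
  have "((\<lambda>x. B x (f x)) has_derivative
      (\<lambda>u. fderiv (\<lambda>x. B x (f y)) y u + B y (fderiv f y u))) (at y)"
    by (rule has_derivative_linear_apply[OF U(1,2) linB])
      (use derB Suc.prems(4) fs in \<open>auto intro: has_fderiv simp: differentiable_def\<close>)
  then show ?case
    unfolding fderivI[OF derB] fs sum.lessThan_Suc_shift by (simp add: B_def add_ac)
qed

lemma has_derivative_bilinear_family:
  fixes B :: "'e::euclidean_space \<Rightarrow> 'e \<Rightarrow> 'e \<Rightarrow> 'f::real_normed_vector" and F :: "'d::euclidean_space \<Rightarrow> 'e"
  assumes U: "open U" "y \<in> U" "F ` U \<subseteq> S" and F: "(F has_derivative F') (at y)"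
    and lin: "\<And>x. x \<in> S \<Longrightarrow> bilinear (B x)" and diff: "\<And>a b. (\<lambda>x. B x a b) differentiable (at (F y))"
    and V: "V differentiable (at y)" and W: "W differentiable (at y)"
  shows "((\<lambda>x. B (F x) (V x) (W x)) has_derivative
    (\<lambda>u. fderiv (\<lambda>z. B z (V y) (W y)) (F y) (F' u) + B (F y) (fderiv V y u) (W y)
      + B (F y) (V y) (fderiv W y u))) (at y)"
proof -
  have ml: "multilinear 2 (\<lambda>vs. B x (vs ! 0) (vs ! 1))" if "x \<in> S" for x
    unfolding multilinear_def using lin[OF that] by (auto simp: less_2_cases_iff bilinear_def)
  show ?thesis
    using has_derivative_tensor[OF U F, of 2 "\<lambda>x vs. B x (vs ! 0) (vs ! 1)" "[V, W]"] ml diff V W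
    by (auto simp: numeral_2_eq_2 add_ac)
qed

section \<open>Metrics on open subsets of the model space\<close>

locale nondeg_form =
  fixes B :: "'e::euclidean_space \<Rightarrow> 'e \<Rightarrow> real"
  assumes bilinear: "bilinear B"
    and symmetric: "B u v = B v u"
    and nondegenerate: "u \<noteq> 0 \<Longrightarrow> \<exists>v. B u v \<noteq> 0"
begin

text \<open>The endomorphism that represents \<open>B\<close> with respect to the Euclidean inner
  product of the model space. Raising an index amounts to inverting it.\<close>

definition gram :: "'e \<Rightarrow> 'e" where
  "gram w = (\<Sum>b\<in>Basis. B w b *\<^sub>R b)"

lemma linear_left: "linear (\<lambda>u. B u v)" and linear_right: "linear (B u)"
  using bilinear by (auto simp: bilinear_def)

lemma linear_gram: "linear gram"
  unfolding gram_def
  by (rule linearI) (simp_all add: bilinear_ladd[OF bilinear] bilinear_lmul[OF bilinear]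
      algebra_simps sum.distrib scaleR_sum_right)

lemma inner_gram: "gram w \<bullet> z = B w z"
  unfolding gram_def inner_sum_left
  by (subst linear_expansion[OF linear_right, of w z]) (simp add: inner_commute mult.commute)

lemma form_eqI: "(\<And>z. B v z = B w z) \<Longrightarrow> v = w"
  using nondegenerate[of "v - w"] by (auto simp: bilinear_lsub[OF bilinear])

lemma inj_gram: "inj gram"
  by (rule injI, rule form_eqI) (simp add: inner_gram[symmetric])

lemma surj_gram: "surj gram"
  using linear_gram inj_gram linear_injective_imp_surjective by blast

text \<open>\<open>gram\<close> is injective by nondegeneracy, hence onto in finite dimension; a
  preimage of the Euclidean representative of \<open>\<alpha>\<close> is the vector sought.\<close>

lemma ex_representer:
  assumes "linear \<alpha>"
  shows "\<exists>w. \<forall>z. B w z = \<alpha> z"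
proof -
  obtain w where w: "gram w = (\<Sum>b\<in>Basis. \<alpha> b *\<^sub>R b)" using surj_gram by (metis surjD)
  have "B w z = \<alpha> z" for z
  proof -
    have "B w z = (\<Sum>b\<in>Basis. \<alpha> b * (z \<bullet> b))"
      unfolding inner_gram[symmetric] w inner_sum_left by (simp add: inner_commute)
    also have "\<dots> = \<alpha> z" using linear_expansion[OF assms, of z] by (simp add: mult.commute)
    finally show ?thesis .
  qed
  then show ?thesis by blast
qed

end

lemma sharp_eqI:
  assumes "nondeg_form (g y)" "\<And>z. g y w z = \<alpha> z"
  shows "sharp g y \<alpha> = w"
  unfolding sharp_def
  by (rule the_equality) (use assms nondeg_form.form_eqI[OF assms(1)] in auto)

lemma sharp_apply:
  assumes "nondeg_form (g y)" "linear \<alpha>"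
  shows "g y (sharp g y \<alpha>) z = \<alpha> z"
  using nondeg_form.ex_representer[OF assms] sharp_eqI[of g y] assms by metis

text \<open>The linear form that \<open>christoffel\<close> raises. As \<open>sharp\<close> is a
  definite description, identities between Christoffel symbols are proved by pairing with
  \<open>z\<close> and comparing such forms.\<close>

definition koszul :: "('e::euclidean_space \<Rightarrow> 'e \<Rightarrow> 'e \<Rightarrow> real) \<Rightarrow> 'e \<Rightarrow> 'e \<Rightarrow> 'e \<Rightarrow> 'e \<Rightarrow> real" where
  "koszul g y u v z =
     (fderiv (\<lambda>x. g x v z) y u + fderiv (\<lambda>x. g x u z) y v - fderiv (\<lambda>x. g x u v) y z) / 2"

lemma christoffel_sharp: "christoffel g y u v = sharp g y (koszul g y u v)"
  unfolding christoffel_def koszul_def ..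

lemma linear_half: "linear f \<Longrightarrow> linear (\<lambda>x. f x / 2 :: real)"
  using linear_compose_scale_right[of f "1/2"] by simp

locale metric_field =
  fixes S :: "'e::euclidean_space set" and g :: "'e \<Rightarrow> 'e \<Rightarrow> 'e \<Rightarrow> real"
  assumes open_S: "open S"
    and form: "y \<in> S \<Longrightarrow> nondeg_form (g y)"
    and smooth: "smooth_on S (\<lambda>y. g y u v)"
begin

lemma lin1: "y \<in> S \<Longrightarrow> linear (\<lambda>u. g y u v)" and lin2: "y \<in> S \<Longrightarrow> linear (\<lambda>v. g y u v)"
  and sym: "y \<in> S \<Longrightarrow> g y u v = g y v u"
  by (fact nondeg_form.linear_left[OF form] nondeg_form.linear_right[OF form] nondeg_form.symmetric[OF form])+

lemma bilin: "y \<in> S \<Longrightarrow> bilinear (g y)"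
  using nondeg_form.bilinear[OF form] .

lemma form_eqI: "y \<in> S \<Longrightarrow> (\<And>z. g y v z = g y w z) \<Longrightarrow> v = w"
  using nondeg_form.form_eqI[OF form] .

lemma metric_differentiable: "y \<in> S \<Longrightarrow> (\<lambda>x. g x u v) differentiable (at y)"
  by (rule smooth_on_differentiable[OF smooth])

text \<open>
  Near \<open>y\<close> the representer \<open>w x\<close> of \<open>\<alpha> x\<close> satisfies a fixed point equation whose linear part
  vanishes at \<open>x = y\<close>; regularity of \<open>w\<close> is read off from it.
\<close>

lemma sharp_fixed_point:
  assumes y: "y \<in> S" and lin: "\<And>x. x \<in> S \<Longrightarrow> linear (\<alpha> x)"
  obtains A P where "linear A" "\<And>c x. P c x = (\<Sum>b\<in>Basis. (g x c b - g y c b) *\<^sub>R A b)"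
    "\<And>x. x \<in> S \<Longrightarrow> sharp g x (\<alpha> x) =
      (\<Sum>b\<in>Basis. \<alpha> x b *\<^sub>R A b) - (\<Sum>c\<in>Basis. (sharp g x (\<alpha> x) \<bullet> c) *\<^sub>R P c x)"
proof -
  interpret y: nondeg_form "g y" by (rule form[OF y])
  \<comment> \<open>\<open>A\<close> inverts the Gram endomorphism at the fixed point
    \<open>y\<close> and does not vary with \<open>x\<close>.\<close>
  obtain A where A: "linear A" "A \<circ> y.gram = id"
    using linear_injective_left_inverse[OF y.linear_gram y.inj_gram] by blast
  define P where "P = (\<lambda>c x. \<Sum>b\<in>Basis. (g x c b - g y c b) *\<^sub>R A b)"
  have "sharp g x (\<alpha> x) = (\<Sum>b\<in>Basis. \<alpha> x b *\<^sub>R A b) - (\<Sum>c\<in>Basis. (sharp g x (\<alpha> x) \<bullet> c) *\<^sub>R P c x)"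
    if x: "x \<in> S" for x
  proof -
    interpret x: nondeg_form "g x" by (rule form[OF x])
    let ?w = "sharp g x (\<alpha> x)"
    have expand: "g p ?w b = (\<Sum>c\<in>Basis. (?w \<bullet> c) * g p c b)" if "p \<in> S" for p b
      using linear_expansion[OF lin1[OF that], of ?w b] by simp
    \<comment> \<open>The form at \<open>y\<close> is traded for the form at \<open>x\<close>: the
      first sum is known, since \<open>?w\<close> represents \<open>\<alpha> x\<close>, and the
      second has coefficients that vanish at \<open>x = y\<close>. Applying \<open>A\<close> gives
      the equation for \<open>?w\<close>.\<close>
    have "y.gram ?w = (\<Sum>b\<in>Basis. g x ?w b *\<^sub>R b) - (\<Sum>b\<in>Basis. (g x ?w b - g y ?w b) *\<^sub>R b)"
      unfolding y.gram_def by (simp add: sum_subtractf[symmetric] algebra_simps)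
    also have "\<dots> = (\<Sum>b\<in>Basis. \<alpha> x b *\<^sub>R b) -
        (\<Sum>c\<in>Basis. (?w \<bullet> c) *\<^sub>R (\<Sum>b\<in>Basis. (g x c b - g y c b) *\<^sub>R b))"
    proof -
      have "(\<Sum>b\<in>Basis. (g x ?w b - g y ?w b) *\<^sub>R b) =
          (\<Sum>b\<in>Basis. \<Sum>c\<in>Basis. ((?w \<bullet> c) * (g x c b - g y c b)) *\<^sub>R b)"
        unfolding expand[OF x] expand[OF y]
        by (simp add: sum_subtractf[symmetric] right_diff_distrib scaleR_sum_left)
      also have "\<dots> = (\<Sum>c\<in>Basis. (?w \<bullet> c) *\<^sub>R (\<Sum>b\<in>Basis. (g x c b - g y c b) *\<^sub>R b))"
        by (subst sum.swap) (simp add: scaleR_sum_right)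
      finally show ?thesis using sharp_apply[of g x "\<alpha> x", OF form[OF x] lin[OF x]] by simp
    qed
    finally have "A (y.gram ?w) = A \<dots>" by simp
    moreover have "A (y.gram ?w) = ?w" using A(2) by (metis comp_apply id_apply)
    ultimately show ?thesis
      unfolding P_def by (simp add: linear_diff[OF A(1)] linear_sum[OF A(1)] linear_cmul[OF A(1)])
  qed
  moreover have "P c x = (\<Sum>b\<in>Basis. (g x c b - g y c b) *\<^sub>R A b)" for c x by (simp add: P_def)
  ultimately show thesis using that[OF A(1)] by blast
qed

text \<open>In the fixed point equation the correction to \<open>a\<close> has norm at most
  \<open>norm (w x) * N x\<close>, where \<open>N\<close> tends to 0. As soon as
  \<open>N x < 1/2\<close> this bounds \<open>w\<close> by twice the norm of \<open>a\<close>; then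
  the correction tends to 0, and \<open>w\<close> tends to \<open>a y\<close>, which is
  \<open>w y\<close>.\<close>

lemma sharp_isCont:
  assumes y: "y \<in> S" and lin: "\<And>x. x \<in> S \<Longrightarrow> linear (\<alpha> x)"
    and cont: "\<And>z. isCont (\<lambda>x. \<alpha> x z) y"
  shows "isCont (\<lambda>x. sharp g x (\<alpha> x)) y"
proof -
  obtain A P where A: "linear A" and P: "\<And>c x. P c x = (\<Sum>b\<in>Basis. (g x c b - g y c b) *\<^sub>R A b)"
    and fp: "\<And>x. x \<in> S \<Longrightarrow> sharp g x (\<alpha> x) =
      (\<Sum>b\<in>Basis. \<alpha> x b *\<^sub>R A b) - (\<Sum>c\<in>Basis. (sharp g x (\<alpha> x) \<bullet> c) *\<^sub>R P c x)"
    using sharp_fixed_point[where \<alpha> = \<alpha>, OF y lin] by blast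
  define w where "w = (\<lambda>x. sharp g x (\<alpha> x))"
  define a where "a = (\<lambda>x. \<Sum>b\<in>Basis. \<alpha> x b *\<^sub>R A b)"
  define N where "N = (\<lambda>x. \<Sum>c\<in>Basis. norm (P c x))"
  have fp': "w x = a x - (\<Sum>c\<in>Basis. (w x \<bullet> c) *\<^sub>R P c x)" if "x \<in> S" for x
    using fp[OF that] unfolding w_def a_def .
  have bound: "norm (\<Sum>c\<in>Basis. (w x \<bullet> c) *\<^sub>R P c x) \<le> norm (w x) * N x" for x
  proof -
    have "norm (\<Sum>c\<in>Basis. (w x \<bullet> c) *\<^sub>R P c x) \<le> (\<Sum>c\<in>Basis. norm (w x) * norm (P c x))"
      by (rule sum_norm_le) (simp add: Basis_le_norm mult_right_mono)
    then show ?thesis by (simp add: N_def sum_distrib_left)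
  qed
  have contg: "isCont (\<lambda>x. g x u v) y" for u v
    by (rule differentiable_imp_continuous_within[OF metric_differentiable[OF y]])
  have "isCont a y" unfolding a_def by (intro continuous_intros cont)
  then have a: "(a \<longlongrightarrow> a y) (at y)" by (simp add: isCont_def)
  have "isCont N y" unfolding N_def P by (intro continuous_intros contg)
  moreover have "N y = 0" by (simp add: N_def P)
  ultimately have N: "(N \<longlongrightarrow> 0) (at y)" by (simp add: isCont_def)
  have inS: "eventually (\<lambda>x. x \<in> S) (at y)" using open_S y eventually_at_in_open' by blast
  have Nhalf: "eventually (\<lambda>x. N x < 1/2) (at y)" using N by (rule order_tendstoD) simp
  have abound: "eventually (\<lambda>x. norm (a x) < norm (a y) + 1) (at y)"
    by (rule order_tendstoD[OF tendsto_norm[OF a]]) simp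
  have "eventually (\<lambda>x. norm (w x - a x) \<le> 2 * (norm (a y) + 1) * N x) (at y)"
    using inS Nhalf abound
  proof eventually_elim
    case (elim x)
    have N0: "N x \<ge> 0" by (simp add: N_def sum_nonneg)
    have le: "norm (w x - a x) \<le> norm (w x) * N x"
      using bound[of x] fp'[OF elim(1)] by (metis minus_diff_eq norm_minus_cancel diff_diff_eq2 add_diff_cancel_left')
    have "norm (w x) * N x \<le> norm (w x) / 2"
      using mult_left_mono[of "N x" "1/2" "norm (w x)"] elim(2) by simp
    moreover have "norm (w x) \<le> norm (a x) + norm (w x - a x)"
      by (metis norm_triangle_sub)
    moreover have "p \<le> 2 * (q + 1)" if "r \<le> p / 2" "p \<le> b + d" "d \<le> r" "b < q + 1" for p q r b d :: real
    proof -
      have "p \<le> b + p / 2" using that(1,2,3) by linarith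
      then have "p \<le> 2 * b" by linarith
      moreover have "2 * b \<le> 2 * (q + 1)" using that(4) by simp
      ultimately show ?thesis by (rule order_trans)
    qed
    ultimately have "norm (w x) \<le> 2 * (norm (a y) + 1)" using le elim(3) by blast
    then have "norm (w x) * N x \<le> 2 * (norm (a y) + 1) * N x" using N0 by (rule mult_right_mono)
    then show ?case using le by linarith
  qed
  moreover have "((\<lambda>x. 2 * (norm (a y) + 1) * N x) \<longlongrightarrow> 0) (at y)"
    using tendsto_mult_left[OF N, of "2 * (norm (a y) + 1)"] by simp
  ultimately have "((\<lambda>x. w x - a x) \<longlongrightarrow> 0) (at y)" by (rule Lim_null_comparison)
  from tendsto_add[OF this a] have "(w \<longlongrightarrow> a y) (at y)" by simp
  moreover have "w y = a y" using fp'[OF y] by (simp add: P)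
  ultimately show ?thesis unfolding isCont_def w_def by simp
qed

text \<open>Each correction term of the fixed point equation is a continuous coefficient times
  \<open>P c\<close>, which is differentiable and zero at \<open>y\<close>, so
  \<open>has_derivative_scaleR_vanishing\<close> applies.\<close>

lemma sharp_differentiable:
  assumes y: "y \<in> S" and lin: "\<And>x. x \<in> S \<Longrightarrow> linear (\<alpha> x)"
    and diff: "\<And>z. (\<lambda>x. \<alpha> x z) differentiable (at y)"
  shows "(\<lambda>x. sharp g x (\<alpha> x)) differentiable (at y)"
proof -
  obtain A P where A: "linear A" and P: "\<And>c x. P c x = (\<Sum>b\<in>Basis. (g x c b - g y c b) *\<^sub>R A b)"
    and fp: "\<And>x. x \<in> S \<Longrightarrow> sharp g x (\<alpha> x) =
      (\<Sum>b\<in>Basis. \<alpha> x b *\<^sub>R A b) - (\<Sum>c\<in>Basis. (sharp g x (\<alpha> x) \<bullet> c) *\<^sub>R P c x)"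
    using sharp_fixed_point[where \<alpha> = \<alpha>, OF y lin] by blast
  have cont: "isCont (\<lambda>x. sharp g x (\<alpha> x)) y"
    by (rule sharp_isCont[OF y lin differentiable_imp_continuous_within[OF diff]])
  have dP: "(P c has_derivative fderiv (P c) y) (at y)" for c
  proof (rule has_fderiv)
    have "(\<lambda>x. \<Sum>b\<in>Basis. (g x c b - g y c b) *\<^sub>R A b) differentiable (at y)"
      by (intro differentiable_sum differentiable_scaleR differentiable_diff differentiable_const
          metric_differentiable y ballI) auto
    then show "P c differentiable (at y)" by (simp add: P[abs_def])
  qed
  have "((\<lambda>x. (sharp g x (\<alpha> x) \<bullet> c) *\<^sub>R P c x) has_derivative
      (\<lambda>h. (sharp g y (\<alpha> y) \<bullet> c) *\<^sub>R fderiv (P c) y h)) (at y)" for c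
    by (rule has_derivative_scaleR_vanishing[OF dP]) (auto simp: P intro!: continuous_intros cont)
  then have "(\<lambda>x. (sharp g x (\<alpha> x) \<bullet> c) *\<^sub>R P c x) differentiable (at y)" for c
    unfolding differentiable_def by blast
  then have "(\<lambda>x. \<Sum>c\<in>Basis. (sharp g x (\<alpha> x) \<bullet> c) *\<^sub>R P c x) differentiable (at y)"
    by (intro differentiable_sum ballI) auto
  moreover have "(\<lambda>x. \<Sum>b\<in>Basis. \<alpha> x b *\<^sub>R A b) differentiable (at y)"
    by (intro differentiable_sum differentiable_scaleR diff differentiable_const ballI) auto
  ultimately have "(\<lambda>x. (\<Sum>b\<in>Basis. \<alpha> x b *\<^sub>R A b) - (\<Sum>c\<in>Basis. (sharp g x (\<alpha> x) \<bullet> c) *\<^sub>R P c x))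
      differentiable (at y)"
    by (intro differentiable_diff)
  from has_fderiv[OF this] have "((\<lambda>x. sharp g x (\<alpha> x)) has_derivative
      fderiv (\<lambda>x. (\<Sum>b\<in>Basis. \<alpha> x b *\<^sub>R A b) -
        (\<Sum>c\<in>Basis. (sharp g x (\<alpha> x) \<bullet> c) *\<^sub>R P c x)) y) (at y)"
    by (rule has_derivative_transform_within_open[OF _ open_S y]) (rule fp[symmetric])
  then show ?thesis unfolding differentiable_def by blast
qed

text \<open>Obtained by differentiating \<open>g x (sharp g x (\<alpha> x)) z = \<alpha> x z\<close>
  in \<open>x\<close>.\<close>

lemma sharp_fderiv:
  assumes y: "y \<in> S" and lin: "\<And>x. x \<in> S \<Longrightarrow> linear (\<alpha> x)"
    and diff: "\<And>z. (\<lambda>x. \<alpha> x z) differentiable (at y)"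
  shows "g y (fderiv (\<lambda>x. sharp g x (\<alpha> x)) y u) z =
    fderiv (\<lambda>x. \<alpha> x z) y u - fderiv (\<lambda>x. g x (sharp g y (\<alpha> y)) z) y u"
proof -
  have A: "((\<lambda>x. g x (sharp g x (\<alpha> x)) z) has_derivative
      (\<lambda>u. fderiv (\<lambda>x. g x (sharp g y (\<alpha> y)) z) y u + g y (fderiv (\<lambda>x. sharp g x (\<alpha> x)) y u) z)) (at y)"
    by (rule has_derivative_linear_apply[OF open_S y lin1 metric_differentiable[OF y]
          has_fderiv[OF sharp_differentiable[OF assms]]])
  have B: "fderiv (\<lambda>x. g x (sharp g x (\<alpha> x)) z) y = fderiv (\<lambda>x. \<alpha> x z) y"
    by (rule fderiv_cong[OF open_S y]) (rule sharp_apply[of g, OF form lin])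
  from fun_cong[OF fderivI[OF A], of u] show ?thesis unfolding B by simp
qed

text \<open>By \<open>sharp_fderiv\<close>, a derivative of the representer is itself the
  representer of a linear form \<open>\<beta>\<close>, with coefficients one order less regular;
  hence the induction over all \<open>\<alpha>\<close>.\<close>

lemma C_k_on_sharp:
  assumes "\<And>x. x \<in> S \<Longrightarrow> linear (\<alpha> x)" "\<And>z. C_k_on k S (\<lambda>x. \<alpha> x z)"
  shows "C_k_on k S (\<lambda>x. sharp g x (\<alpha> x))"
  using assms
proof (induction k arbitrary: \<alpha>)
  case 0
  then show ?case
    using sharp_isCont[of _ \<alpha>] by (auto simp: continuous_on_eq_continuous_at[OF open_S])
next
  case (Suc k)
  have diff: "(\<lambda>x. \<alpha> x z) differentiable (at y)" if "y \<in> S" for y z using Suc.prems(2) that by auto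
  let ?w = "\<lambda>x. sharp g x (\<alpha> x)"
  \<comment> \<open>The form \<open>\<beta>\<close> contains \<open>?w\<close>, so the induction
    hypothesis is used on \<open>\<alpha>\<close> itself before it is used on
    \<open>\<beta>\<close>.\<close>
  have w: "C_k_on k S ?w"
    by (rule Suc.IH) (use Suc.prems C_k_on_Suc_imp in blast)+
  show ?case
  proof (simp, intro conjI ballI allI)
    show "?w differentiable (at y)" if "y \<in> S" for y
      by (rule sharp_differentiable[where \<alpha> = \<alpha>, OF that Suc.prems(1) diff[OF that]])
    fix v
    define \<beta> where "\<beta> = (\<lambda>y z. g y (fderiv ?w y v) z)"
    have \<beta>: "\<beta> y z = fderiv (\<lambda>x. \<alpha> x z) y v - (\<Sum>c\<in>Basis. (?w y \<bullet> c) * fderiv (\<lambda>x. g x c z) y v)"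
      if y: "y \<in> S" for y z
    proof -
      have "\<beta> y z = fderiv (\<lambda>x. \<alpha> x z) y v - fderiv (\<lambda>x. g x (?w y) z) y v"
        unfolding \<beta>_def by (rule sharp_fderiv[OF y Suc.prems(1) diff[OF y]])
      then show ?thesis
        using linear_expansion[OF linear_fderiv_family[OF open_S y lin1 metric_differentiable[OF y]], of "?w y" z v]
        by simp
    qed
    have "C_k_on k S (\<lambda>x. sharp g x (\<beta> x))"
    proof (rule Suc.IH)
      show "linear (\<beta> y)" if "y \<in> S" for y unfolding \<beta>_def using lin2[OF that] .
      fix z
      have "C_k_on k S (\<lambda>y. fderiv (\<lambda>x. \<alpha> x z) y v + - 1 *\<^sub>R (\<Sum>c\<in>Basis. (?w y \<bullet> c) *\<^sub>R fderiv (\<lambda>x. g x c z) y v))"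
        using Suc.prems(2)
        by (intro C_k_on_add C_k_on_sum C_k_on_scaleR C_k_on_const open_S
            C_k_on_bounded_linear[OF open_S bounded_linear_inner_left w]
            smooth_onD[OF smooth_on_fderiv[OF smooth]]) auto
      then show "C_k_on k S (\<lambda>y. \<beta> y z)"
        by (rule C_k_on_cong[OF open_S, rotated]) (simp add: \<beta>)
    qed
    then show "C_k_on k S (\<lambda>y. fderiv ?w y v)"
      by (rule C_k_on_cong[OF open_S, rotated]) (auto intro: sharp_eqI form simp: \<beta>_def)
  qed
qed

lemma smooth_on_sharp:
  assumes "\<And>x. x \<in> S \<Longrightarrow> linear (\<alpha> x)" "\<And>z. smooth_on S (\<lambda>x. \<alpha> x z)"
  shows "smooth_on S (\<lambda>x. sharp g x (\<alpha> x))"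
  using C_k_on_sharp[where \<alpha> = \<alpha>, OF assms(1)] assms(2) unfolding smooth_on_def by blast

section \<open>Levi-Civita connection and curvature on an open set\<close>

lemma fderiv_lin1: "y \<in> S \<Longrightarrow> linear (\<lambda>u. fderiv (\<lambda>x. g x u v) y w)"
  by (rule linear_fderiv_family[OF open_S _ lin1 metric_differentiable])

lemma fderiv_lin2: "y \<in> S \<Longrightarrow> linear (\<lambda>v. fderiv (\<lambda>x. g x u v) y w)"
  by (rule linear_fderiv_family[OF open_S _ lin2 metric_differentiable])

lemma fderiv_dir: "y \<in> S \<Longrightarrow> linear (\<lambda>w. fderiv (\<lambda>x. g x u v) y w)"
  by (rule linear_frechet_derivative[OF metric_differentiable])

lemma fderiv_sym: "y \<in> S \<Longrightarrow> fderiv (\<lambda>x. g x u v) y = fderiv (\<lambda>x. g x v u) y"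
  by (rule fderiv_cong[OF open_S]) (auto intro: sym)

lemma koszul_linear: "y \<in> S \<Longrightarrow> linear (koszul g y u v)"
  unfolding koszul_def
  by (intro linear_half linear_compose_sub linear_compose_add fderiv_lin2 fderiv_dir)

lemma koszul_linear1: "y \<in> S \<Longrightarrow> linear (\<lambda>u. koszul g y u v z)"
  unfolding koszul_def
  by (intro linear_half linear_compose_sub linear_compose_add fderiv_lin1 fderiv_dir)

lemma koszul_sym: "y \<in> S \<Longrightarrow> koszul g y u v z = koszul g y v u z"
  unfolding koszul_def by (simp add: fderiv_sym[of y u v])

lemma christoffel_koszul: "y \<in> S \<Longrightarrow> g y (christoffel g y u v) z = koszul g y u v z"
  unfolding christoffel_sharp by (intro sharp_apply form koszul_linear)

lemma christoffel_sym: "y \<in> S \<Longrightarrow> christoffel g y u v = christoffel g y v u"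
  by (rule form_eqI) (auto simp: christoffel_koszul intro: koszul_sym)

lemma christoffel_lin1: "y \<in> S \<Longrightarrow> linear (\<lambda>u. christoffel g y u v)"
  by (rule linearI; rule form_eqI[of y])
    (simp_all add: christoffel_koszul linear_add[OF lin1] linear_cmul[OF lin1]
      linear_add[OF koszul_linear1] linear_cmul[OF koszul_linear1])

lemma christoffel_lin2: "y \<in> S \<Longrightarrow> linear (\<lambda>v. christoffel g y u v)"
  using christoffel_lin1[of y u] by (simp add: christoffel_sym)

lemma christoffel_bilinear: "y \<in> S \<Longrightarrow> bilinear (christoffel g y)"
  using christoffel_lin1 christoffel_lin2 by (simp add: bilinear_def)

lemma smooth_koszul: "smooth_on S (\<lambda>y. koszul g y u v z)"
  unfolding koszul_def
  by (intro smooth_on_bounded_linear[OF open_S bounded_linear_divide] smooth_on_diff smooth_on_add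
      smooth_on_fderiv smooth open_S)

lemma smooth_christoffel: "smooth_on S (\<lambda>y. christoffel g y u v)"
  unfolding christoffel_sharp by (intro smooth_on_sharp koszul_linear smooth_koszul)

lemma christoffel_differentiable: "y \<in> S \<Longrightarrow> (\<lambda>x. christoffel g x u v) differentiable (at y)"
  by (rule smooth_on_differentiable[OF smooth_christoffel])

lemma fderiv_christoffel_lin1: "y \<in> S \<Longrightarrow> linear (\<lambda>u. fderiv (\<lambda>x. christoffel g x u v) y w)"
  by (rule linear_fderiv_family[OF open_S _ christoffel_lin1 christoffel_differentiable])

lemma fderiv_christoffel_lin2: "y \<in> S \<Longrightarrow> linear (\<lambda>v. fderiv (\<lambda>x. christoffel g x u v) y w)"
  by (rule linear_fderiv_family[OF open_S _ christoffel_lin2 christoffel_differentiable])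

lemma fderiv_christoffel_dir: "y \<in> S \<Longrightarrow> linear (\<lambda>w. fderiv (\<lambda>x. christoffel g x u v) y w)"
  by (rule linear_frechet_derivative[OF christoffel_differentiable])

lemma curvature_op_lin1: "y \<in> S \<Longrightarrow> linear (\<lambda>u. curvature_op g y u v w)"
  unfolding curvature_op_def
  by (intro linear_compose_sub linear_compose_add fderiv_christoffel_lin1 fderiv_christoffel_dir
      christoffel_lin1 linear_compose[OF christoffel_lin1 christoffel_lin2, unfolded o_def])

lemma curvature_op_antisym: "curvature_op g y u v w = - curvature_op g y v u w"
  unfolding curvature_op_def by simp

lemma curvature_op_lin2: "y \<in> S \<Longrightarrow> linear (\<lambda>v. curvature_op g y u v w)"
  using linear_compose_neg[OF curvature_op_lin1[of y u w]] by (simp add: curvature_op_antisym[of y u])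

lemma curvature_op_lin3: "y \<in> S \<Longrightarrow> linear (\<lambda>w. curvature_op g y u v w)"
  unfolding curvature_op_def
  by (intro linear_compose_sub linear_compose_add fderiv_christoffel_lin2
      linear_compose[OF christoffel_lin2 christoffel_lin2, unfolded o_def])

lemma smooth_curvature_op: "smooth_on S (\<lambda>y. curvature_op g y u v w)"
  unfolding curvature_op_def
  by (intro smooth_on_diff smooth_on_add smooth_on_fderiv open_S smooth_christoffel
      smooth_on_linear_apply[OF open_S christoffel_lin2])

lemma tensor_field_curvature: "tensor_field S 4 (curvature_tensor g)"
proof -
  have "linear (\<lambda>w. curvature_tensor g y (vs[i := w]))" if y: "y \<in> S" and len: "length vs = 4" and i: "i < 4" for y vs i
  proof -
    note lin = linear_compose[OF curvature_op_lin1 lin1, unfolded o_def]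
      linear_compose[OF curvature_op_lin2 lin1, unfolded o_def]
      linear_compose[OF curvature_op_lin3 lin1, unfolded o_def]
    obtain a b c d where vs: "vs = [a, b, c, d]"
      using len by (auto simp: numeral_eq_Suc length_Suc_conv)
    have "linear (\<lambda>w. curvature_tensor g y [w, b, c, d])" "linear (\<lambda>w. curvature_tensor g y [a, w, c, d])"
      "linear (\<lambda>w. curvature_tensor g y [a, b, w, d])" "linear (\<lambda>w. curvature_tensor g y [a, b, c, w])"
      unfolding curvature_tensor_def
      using lin(1)[OF y y, of b c d] lin(2)[OF y y, of a c d] lin(3)[OF y y, of a b d]
        lin2[OF y, of "curvature_op g y a b c"] by (simp_all add: numeral_eq_Suc)
    moreover have "i = 0 \<or> i = 1 \<or> i = 2 \<or> i = 3" using i by arith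
    ultimately show ?thesis unfolding vs by (auto simp: numeral_eq_Suc)
  qed
  moreover have "smooth_on S (\<lambda>y. curvature_tensor g y vs)" for vs
    unfolding curvature_tensor_def
    by (rule smooth_on_linear_apply[OF open_S lin1 smooth smooth_curvature_op])
  ultimately show ?thesis unfolding tensor_field_def multilinear_def by blast
qed

lemma tensor_field_covariant_derivative:
  assumes T: "tensor_field S n T"
  shows "tensor_field S (Suc n) (covariant_derivative g T)"
proof -
  have smoothT: "smooth_on S (\<lambda>y. T y vs)" if "length vs = n" for vs
    using T that by (simp add: tensor_field_def)
  have diffT: "(\<lambda>x. T x vs) differentiable (at y)" if "length vs = n" "y \<in> S" for y vs
    using smooth_on_differentiable[OF smoothT] that by blast
  have linT: "linear (\<lambda>w. T y (vs[i := w]))" if "y \<in> S" "length vs = n" "i < n" for y vs i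
    using T that by (simp add: tensor_field_def multilinear_def)
  have "linear (\<lambda>w. covariant_derivative g T y (vs[i := w]))"
    if y: "y \<in> S" and len: "length vs = Suc n" and i: "i < Suc n" for y vs i
  proof -
    obtain u ws where vs: "vs = u # ws" and ws: "length ws = n" using len by (cases vs) auto
    show ?thesis
    proof (cases i)
      case 0
      have "linear (\<lambda>w. fderiv (\<lambda>x. T x ws) y w - (\<Sum>j<n. T y (ws[j := christoffel g y w (ws ! j)])))"
        by (intro linear_compose_sub linear_compose_sum ballI linear_frechet_derivative diffT ws y
            linear_compose[OF christoffel_lin1 linT, unfolded o_def]) auto
      then show ?thesis unfolding vs 0 covariant_derivative_def by (simp add: ws)
    next
      case (Suc j)
      have j: "j < n" using Suc i by simp
      \<comment> \<open>Where the connection acts on the varied slot \<open>j\<close> itself,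
        \<open>w\<close> enters through the Christoffel symbol; on any other slot the two updates
        commute.\<close>
      have "linear (\<lambda>w. T y (ws[j := w, k := christoffel g y u (ws[j := w] ! k)]))" if k: "k < n" for k
      proof (cases "k = j")
        case True
        then show ?thesis using linear_compose[OF christoffel_lin2[OF y] linT[OF y ws j]] j ws
          by (simp add: o_def)
      next
        case False
        then show ?thesis using linT[OF y, of "ws[k := christoffel g y u (ws ! k)]" j] ws j
          by (simp add: list_update_swap)
      qed
      then have "linear (\<lambda>w. fderiv (\<lambda>x. T x (ws[j := w])) y u -
          (\<Sum>k<n. T y (ws[j := w, k := christoffel g y u (ws[j := w] ! k)])))"
        by (intro linear_compose_sub linear_compose_sum ballI
            linear_fderiv_family[OF open_S y linT] diffT y) (auto simp: ws j)
      then show ?thesis unfolding vs Suc covariant_derivative_def by (simp add: ws Let_def)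
    qed
  qed
  moreover have "smooth_on S (\<lambda>y. covariant_derivative g T y vs)" if len: "length vs = Suc n" for vs
  proof -
    obtain u ws where vs: "vs = u # ws" and ws: "length ws = n" using len by (cases vs) auto
    have "smooth_on S (\<lambda>y. T y (ws[j := christoffel g y u (ws ! j)]))" if "j < n" for j
      by (rule smooth_on_linear_apply[where B = "\<lambda>y w. T y (ws[j := w])", OF open_S linT _ smooth_christoffel])
        (auto simp: ws that intro: smoothT)
    then have "smooth_on S (\<lambda>y. fderiv (\<lambda>x. T x ws) y u - (\<Sum>j<n. T y (ws[j := christoffel g y u (ws ! j)])))"
      by (intro smooth_on_diff smooth_on_sum smooth_on_fderiv open_S smoothT ws) auto
    then show ?thesis unfolding vs covariant_derivative_def by (simp add: ws)
  qed
  ultimately show ?thesis unfolding tensor_field_def multilinear_def by blast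
qed

lemma tensor_field_nabla_curvature: "tensor_field S (l + 4) (nabla_curvature l g)"
proof (induction l)
  case 0
  show ?case using tensor_field_curvature by simp
next
  case (Suc l)
  show ?case
    using tensor_field_covariant_derivative[OF Suc] by (simp only: nabla_curvature.simps add_Suc)
qed

end

section \<open>Behaviour of the curvature under homotheties\<close>

text \<open>The constant \<open>c\<close> is 1 for changes of chart and for isometries of
  \<open>N\<close>; it becomes \<open>exp (t * r)\<close> when the line is translated by
  \<open>r\<close>.\<close>

locale local_homothety = src: metric_field S g + tgt: metric_field S' g'
  for S :: "'e::euclidean_space set" and g and S' :: "'e set" and g' +
  fixes F :: "'e \<Rightarrow> 'e" and c :: real
  assumes F_maps: "y \<in> S \<Longrightarrow> F y \<in> S'"
    and F_smooth: "smooth_on S F"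
    and F_metric: "y \<in> S \<Longrightarrow> g' (F y) (fderiv F y u) (fderiv F y v) = c * g y u v"
    and c_nz: "c \<noteq> 0"
begin

text \<open>The inhomogeneous term in the transformation law of the Christoffel symbols; it has to
  cancel from every tensor.\<close>

abbreviation D2 :: "'e \<Rightarrow> 'e \<Rightarrow> 'e \<Rightarrow> 'e" where
  "D2 y u v \<equiv> fderiv (\<lambda>x. fderiv F x v) y u"

lemma F_deriv: "y \<in> S \<Longrightarrow> (F has_derivative fderiv F y) (at y)"
  by (rule has_fderiv[OF smooth_on_differentiable[OF F_smooth]])

lemma linear_J: "y \<in> S \<Longrightarrow> linear (fderiv F y)"
  by (rule linear_frechet_derivative[OF smooth_on_differentiable[OF F_smooth]])

lemma J_differentiable: "y \<in> S \<Longrightarrow> (\<lambda>x. fderiv F x v) differentiable (at y)"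
  by (rule smooth_on_differentiable[OF smooth_on_fderiv[OF F_smooth]])

lemma D2_differentiable: "y \<in> S \<Longrightarrow> (\<lambda>x. D2 x u v) differentiable (at y)"
  by (rule smooth_on_differentiable[OF smooth_on_fderiv[OF smooth_on_fderiv[OF F_smooth]]])

lemma D2_sym: "y \<in> S \<Longrightarrow> D2 y u v = D2 y v u"
  by (rule second_derivative_symmetric[OF F_smooth src.open_S])

lemma D3_sym: "y \<in> S \<Longrightarrow> fderiv (\<lambda>x. D2 x v w) y u = fderiv (\<lambda>x. D2 x u w) y v"
  by (rule second_derivative_symmetric[OF smooth_on_fderiv[OF F_smooth] src.open_S])

text \<open>Vectors with the same image under \<open>fderiv F y\<close> pair equally with every
  vector under \<open>g y\<close>, which is nondegenerate.\<close>

lemma inj_J: "y \<in> S \<Longrightarrow> inj (fderiv F y)"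
proof (rule injI)
  fix u v assume y: "y \<in> S" and eq: "fderiv F y u = fderiv F y v"
  show "u = v"
    by (rule src.form_eqI[OF y]) (use F_metric[OF y] eq c_nz in \<open>metis mult_left_cancel\<close>)
qed

lemma surj_J: "y \<in> S \<Longrightarrow> surj (fderiv F y)"
  using linear_injective_imp_surjective linear_J inj_J by blast

lemma form_eqI_J:
  assumes "y \<in> S" "\<And>z. g' (F y) v (fderiv F y z) = g' (F y) w (fderiv F y z)"
  shows "v = w"
  by (rule tgt.form_eqI[OF F_maps[OF assms(1)]]) (use assms(2) surj_J[OF assms(1)] in \<open>metis surjD\<close>)

lemma image_F: "F ` S \<subseteq> S'"
  using F_maps by auto

lemma metric_fderiv:
  assumes y: "y \<in> S"
  shows "c * fderiv (\<lambda>x. g x v w) y u =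
    fderiv (\<lambda>x. g' x (fderiv F y v) (fderiv F y w)) (F y) (fderiv F y u)
    + g' (F y) (D2 y u v) (fderiv F y w) + g' (F y) (fderiv F y v) (D2 y u w)"
proof -
  have "((\<lambda>x. g' (F x) (fderiv F x v) (fderiv F x w)) has_derivative
      (\<lambda>u. fderiv (\<lambda>x. g' x (fderiv F y v) (fderiv F y w)) (F y) (fderiv F y u)
        + g' (F y) (D2 y u v) (fderiv F y w) + g' (F y) (fderiv F y v) (D2 y u w))) (at y)"
    by (rule has_derivative_bilinear_family[OF src.open_S y image_F F_deriv[OF y] tgt.bilin
        tgt.metric_differentiable[OF F_maps[OF y]] J_differentiable[OF y] J_differentiable[OF y]])
  then have R: "((\<lambda>x. c * g x v w) has_derivative
      (\<lambda>u. fderiv (\<lambda>x. g' x (fderiv F y v) (fderiv F y w)) (F y) (fderiv F y u)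
        + g' (F y) (D2 y u v) (fderiv F y w) + g' (F y) (fderiv F y v) (D2 y u w))) (at y)"
    by (rule has_derivative_transform_within_open[OF _ src.open_S y]) (rule F_metric)
  have L: "((\<lambda>x. c * g x v w) has_derivative (\<lambda>u. c * fderiv (\<lambda>x. g x v w) y u)) (at y)"
    by (intro has_derivative_mult_right has_fderiv src.metric_differentiable y)
  show ?thesis using fun_cong[OF has_derivative_unique[OF L R]] .
qed

lemma christoffel_transform:
  assumes y: "y \<in> S"
  shows "fderiv F y (christoffel g y u v) =
    christoffel g' (F y) (fderiv F y u) (fderiv F y v) + D2 y u v"
proof (rule form_eqI_J[OF y])
  fix z
  have Fy: "F y \<in> S'" by (rule F_maps[OF y])
  have "g' (F y) (fderiv F y (christoffel g y u v)) (fderiv F y z) = c * koszul g y u v z"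
    by (simp add: F_metric[OF y] src.christoffel_koszul[OF y])
  also have "\<dots> = (c * fderiv (\<lambda>x. g x v z) y u + c * fderiv (\<lambda>x. g x u z) y v
      - c * fderiv (\<lambda>x. g x u v) y z) / 2"
    unfolding koszul_def by (simp add: algebra_simps)
  \<comment> \<open>The three derivatives of the metric produce six terms in \<open>D2\<close>. By
    symmetry four of them cancel, and the two with \<open>D2 y u v\<close> add up; the division by 2
    leaves one.\<close>
  also have "\<dots> = koszul g' (F y) (fderiv F y u) (fderiv F y v) (fderiv F y z)
      + g' (F y) (D2 y u v) (fderiv F y z)"
    unfolding metric_fderiv[OF y] koszul_def
    by (simp add: D2_sym[OF y, of v u] D2_sym[OF y, of z u] D2_sym[OF y, of z v]
        tgt.sym[OF Fy, of "fderiv F y v"] tgt.sym[OF Fy, of "fderiv F y u"] field_simps)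
  also have "\<dots> = g' (F y) (christoffel g' (F y) (fderiv F y u) (fderiv F y v) + D2 y u v) (fderiv F y z)"
    by (simp add: tgt.christoffel_koszul[OF Fy] linear_add[OF tgt.lin1[OF Fy]])
  finally show "g' (F y) (fderiv F y (christoffel g y u v)) (fderiv F y z) =
    g' (F y) (christoffel g' (F y) (fderiv F y u) (fderiv F y v) + D2 y u v) (fderiv F y z)" .
qed

lemma christoffel_fderiv:
  assumes y: "y \<in> S"
  shows "D2 y u (christoffel g y v w) + fderiv F y (fderiv (\<lambda>x. christoffel g x v w) y u) =
    fderiv (\<lambda>x. christoffel g' x (fderiv F y v) (fderiv F y w)) (F y) (fderiv F y u)
    + christoffel g' (F y) (D2 y u v) (fderiv F y w) + christoffel g' (F y) (fderiv F y v) (D2 y u w)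
    + fderiv (\<lambda>x. D2 x v w) y u"
proof -
  have "((\<lambda>x. christoffel g' (F x) (fderiv F x v) (fderiv F x w) + D2 x v w) has_derivative
      (\<lambda>u. fderiv (\<lambda>x. christoffel g' x (fderiv F y v) (fderiv F y w)) (F y) (fderiv F y u)
        + christoffel g' (F y) (D2 y u v) (fderiv F y w) + christoffel g' (F y) (fderiv F y v) (D2 y u w)
        + fderiv (\<lambda>x. D2 x v w) y u)) (at y)"
    by (rule has_derivative_add[OF has_derivative_bilinear_family[OF src.open_S y image_F F_deriv[OF y]
        tgt.christoffel_bilinear tgt.christoffel_differentiable[OF F_maps[OF y]]
        J_differentiable[OF y] J_differentiable[OF y]] has_fderiv[OF D2_differentiable[OF y]]])
  then have R: "((\<lambda>x. fderiv F x (christoffel g x v w)) has_derivative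
      (\<lambda>u. fderiv (\<lambda>x. christoffel g' x (fderiv F y v) (fderiv F y w)) (F y) (fderiv F y u)
        + christoffel g' (F y) (D2 y u v) (fderiv F y w) + christoffel g' (F y) (fderiv F y v) (D2 y u w)
        + fderiv (\<lambda>x. D2 x v w) y u)) (at y)"
    by (rule has_derivative_transform_within_open[OF _ src.open_S y]) (rule christoffel_transform[symmetric])
  have L: "((\<lambda>x. fderiv F x (christoffel g x v w)) has_derivative
      (\<lambda>u. D2 y u (christoffel g y v w) + fderiv F y (fderiv (\<lambda>x. christoffel g x v w) y u))) (at y)"
    by (rule has_derivative_linear_apply[OF src.open_S y linear_J J_differentiable[OF y]
        has_fderiv[OF src.christoffel_differentiable[OF y]]])
  show ?thesis using fun_cong[OF has_derivative_unique[OF L R]] .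
qed

text \<open>Third derivatives cancel by \<open>D3_sym\<close> and the term in
  \<open>D2 y u v\<close> by its symmetry; the remaining second-order terms from derivatives of
  Christoffel symbols cancel against those from their products.\<close>

lemma curvature_op_transform:
  assumes y: "y \<in> S"
  shows "fderiv F y (curvature_op g y u v w) =
    curvature_op g' (F y) (fderiv F y u) (fderiv F y v) (fderiv F y w)"
proof -
  have Fy: "F y \<in> S'" by (rule F_maps[OF y])
  have d: "fderiv F y (fderiv (\<lambda>x. christoffel g x v w) y u) =
    fderiv (\<lambda>x. christoffel g' x (fderiv F y v) (fderiv F y w)) (F y) (fderiv F y u)
    + christoffel g' (F y) (D2 y u v) (fderiv F y w) + christoffel g' (F y) (fderiv F y v) (D2 y u w)
    + fderiv (\<lambda>x. D2 x v w) y u - D2 y u (christoffel g y v w)" for u v w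
    using christoffel_fderiv[OF y, where u = u and v = v and w = w] by (simp add: algebra_simps)
  have q: "fderiv F y (christoffel g y u (christoffel g y v w)) =
    christoffel g' (F y) (fderiv F y u) (christoffel g' (F y) (fderiv F y v) (fderiv F y w))
    + christoffel g' (F y) (fderiv F y u) (D2 y v w) + D2 y u (christoffel g y v w)" for u v w
    by (simp add: christoffel_transform[OF y] linear_add[OF tgt.christoffel_lin2[OF Fy]])
  show ?thesis
    unfolding curvature_op_def linear_diff[OF linear_J[OF y]] linear_add[OF linear_J[OF y]] d q
    by (simp add: D2_sym[OF y, of v u] D3_sym[OF y, where u = u and v = v and w = w])
qed

text \<open>The connection and the curvature operator transform without a factor, and the metric is
  used once, to lower the last index; so the factor is \<open>c\<close> for every \<open>l\<close>.
  The equation holds at all points of \<open>S\<close>, which allows it to be differentiated in the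
  induction step.\<close>

lemma nabla_curvature_transform:
  "y \<in> S \<Longrightarrow> length vs = l + 4 \<Longrightarrow>
    nabla_curvature l g' (F y) (map (fderiv F y) vs) = c * nabla_curvature l g y vs"
proof (induction l arbitrary: y vs)
  case 0
  then show ?case
    by (simp add: curvature_tensor_def curvature_op_transform[symmetric] F_metric)
next
  case (Suc l)
  note y = \<open>y \<in> S\<close>
  have Fy: "F y \<in> S'" by (rule F_maps[OF y])
  let ?T = "nabla_curvature l g" and ?T' = "nabla_curvature l g'" and ?J = "fderiv F y"
  obtain u ws where vs: "vs = u # ws" and ws: "length ws = l + 4" using Suc.prems by (cases vs) auto
  have T: "tensor_field S (l + 4) ?T" by (rule src.tensor_field_nabla_curvature)
  have T': "tensor_field S' (l + 4) ?T'" by (rule tgt.tensor_field_nabla_curvature)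
  have diffT': "(\<lambda>x. ?T' x vs) differentiable (at (F y))" if "length vs = l + 4" for vs
    using T' that Fy smooth_on_differentiable unfolding tensor_field_def by blast
  have diffT: "(\<lambda>x. ?T x ws) differentiable (at y)"
    using T ws y smooth_on_differentiable unfolding tensor_field_def by blast
  let ?R = "\<lambda>u. fderiv (\<lambda>x. ?T' x (map ?J ws)) (F y) (?J u)
        + (\<Sum>i<l + 4. ?T' (F y) ((map ?J ws)[i := D2 y u (ws ! i)]))"
  have "((\<lambda>x. ?T' (F x) (map (\<lambda>f. f x) (map (\<lambda>w x. fderiv F x w) ws))) has_derivative
      (\<lambda>u. fderiv (\<lambda>x. ?T' x (map (\<lambda>f. f y) (map (\<lambda>w x. fderiv F x w) ws))) (F y) (?J u)
        + (\<Sum>i<l + 4. ?T' (F y) ((map (\<lambda>f. f y) (map (\<lambda>w x. fderiv F x w) ws))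
            [i := fderiv (map (\<lambda>w x. fderiv F x w) ws ! i) y u])))) (at y)"
    by (rule has_derivative_tensor[OF src.open_S y image_F F_deriv[OF y]])
      (use T' ws diffT' J_differentiable[OF y] in \<open>auto simp: tensor_field_def\<close>)
  then have "((\<lambda>x. ?T' (F x) (map (fderiv F x) ws)) has_derivative ?R) (at y)"
    by (simp add: o_def ws cong: sum.cong_simp)
  then have R: "((\<lambda>x. c * ?T x ws) has_derivative ?R) (at y)"
    by (rule has_derivative_transform_within_open[OF _ src.open_S y]) (simp add: Suc.IH ws)
  have L: "((\<lambda>x. c * ?T x ws) has_derivative (\<lambda>u. c * fderiv (\<lambda>x. ?T x ws) y u)) (at y)"
    by (intro has_derivative_mult_right has_fderiv diffT)
  have der: "c * fderiv (\<lambda>x. ?T x ws) y u = ?R u" using fun_cong[OF has_derivative_unique[OF L R]] .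
  have lin: "linear (\<lambda>w. ?T' (F y) ((map ?J ws)[i := w]))" if "i < l + 4" for i
    using T' Fy that ws by (simp add: tensor_field_def multilinear_def)
  \<comment> \<open>\<open>christoffel_transform\<close> puts a second derivative of
    \<open>F\<close> into the slot; summed over all slots, these are the terms that the Leibniz rule
    produces in \<open>?R\<close>.\<close>
  have slot: "c * ?T y (ws[i := christoffel g y u (ws ! i)]) =
      ?T' (F y) ((map ?J ws)[i := christoffel g' (F y) (?J u) (?J (ws ! i))])
      + ?T' (F y) ((map ?J ws)[i := D2 y u (ws ! i)])" if i: "i < l + 4" for i
    using Suc.IH[OF y, of "ws[i := christoffel g y u (ws ! i)]"] ws linear_add[OF lin[OF i]]
    by (simp add: map_update christoffel_transform[OF y])
  have "c * (\<Sum>i<l + 4. ?T y (ws[i := christoffel g y u (ws ! i)])) =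
      (\<Sum>i<l + 4. ?T' (F y) ((map ?J ws)[i := christoffel g' (F y) (?J u) (?J (ws ! i))]))
      + (\<Sum>i<l + 4. ?T' (F y) ((map ?J ws)[i := D2 y u (ws ! i)]))"
    unfolding sum_distrib_left sum.distrib[symmetric] by (rule sum.cong) (auto simp: slot)
  then show ?case
    unfolding vs by (simp add: covariant_derivative_def ws right_diff_distrib der Let_def cong: sum.cong_simp)
qed

end

section \<open>Invariance of the scalar curvature\<close>

lemma sum_Basis_prod:
  fixes f :: "'a::euclidean_space \<times> 'b::euclidean_space \<Rightarrow> 'c::comm_monoid_add"
  shows "sum f Basis = (\<Sum>i\<in>Basis. f (i, 0)) + (\<Sum>i\<in>Basis. f (0, i))"
proof -
  have "inj_on (\<lambda>u. (u :: 'a, 0 :: 'b)) Basis" "inj_on (\<lambda>u. (0 :: 'a, u :: 'b)) Basis"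
    by (auto intro!: inj_onI)
  then show ?thesis
    unfolding Basis_prod_def by (subst sum.union_disjoint) (auto simp: sum.reindex)
qed

lemma trace_compose_commute:
  fixes f :: "'f::euclidean_space \<Rightarrow> 'e::euclidean_space" and h :: "'e \<Rightarrow> 'f"
  assumes "linear f" "linear h"
  shows "(\<Sum>b\<in>Basis. f (h b) \<bullet> b) = (\<Sum>c\<in>Basis. h (f c) \<bullet> c)"
proof -
  have "(\<Sum>b\<in>Basis. f (h b) \<bullet> b) = (\<Sum>b\<in>Basis. \<Sum>c\<in>Basis. (h b \<bullet> c) * (f c \<bullet> b))"
    by (rule sum.cong[OF refl], subst linear_expansion[OF assms(1)]) (simp add: inner_sum_left)
  also have "\<dots> = (\<Sum>c\<in>Basis. \<Sum>b\<in>Basis. (f c \<bullet> b) * (h b \<bullet> c))"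
    by (subst sum.swap) (simp add: mult.commute)
  also have "\<dots> = (\<Sum>c\<in>Basis. h (f c) \<bullet> c)"
    by (rule sum.cong[OF refl], subst (2) linear_expansion[OF assms(2)]) (simp add: inner_sum_left)
  finally show ?thesis .
qed

text \<open>\<open>A'\<close> is the conjugate of \<open>A\<close> by \<open>\<phi>\<close>, and
  \<open>trace_compose_commute\<close> moves \<open>\<phi>\<close> around the product.\<close>

lemma trace_conjugate:
  fixes \<phi> :: "'e::euclidean_space \<Rightarrow> 'e"
  assumes A: "linear A" and \<phi>: "linear \<phi>" "bij \<phi>" and eq: "\<And>u. A' (\<phi> u) = \<phi> (A u)"
  shows "(\<Sum>b\<in>Basis. A' b \<bullet> b) = (\<Sum>b\<in>Basis. A b \<bullet> b)"
proof -
  obtain \<psi> where \<psi>: "linear \<psi>" "\<psi> \<circ> \<phi> = id"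
    using linear_injective_left_inverse[OF \<phi>(1) bij_is_inj[OF \<phi>(2)]] by blast
  have inv: "\<psi> (\<phi> u) = u" for u using \<psi>(2) by (metis comp_apply id_apply)
  have "A' b = \<phi> (A (\<psi> b))" for b
  proof -
    obtain u where "b = \<phi> u" using bij_is_surj[OF \<phi>(2)] by (metis surjD)
    then show ?thesis by (simp add: eq inv)
  qed
  then have "(\<Sum>b\<in>Basis. A' b \<bullet> b) = (\<Sum>b\<in>Basis. (A \<circ> \<psi>) (\<phi> b) \<bullet> b)"
    using trace_compose_commute[OF \<phi>(1) linear_compose[OF \<psi>(1) A]] by simp
  then show ?thesis by (simp add: inv)
qed

context metric_field
begin

lemma linear_ricci: "y \<in> S \<Longrightarrow> linear (ricci g y v)"
  unfolding ricci_def
  by (rule linearI) (simp_all add: linear_add[OF curvature_op_lin3] linear_cmul[OF curvature_op_lin3]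
      inner_add_left sum.distrib sum_distrib_left)

lemma linear_ricci1: "y \<in> S \<Longrightarrow> linear (\<lambda>v. ricci g y v w)"
  unfolding ricci_def
  by (rule linearI) (simp_all add: linear_add[OF curvature_op_lin2] linear_cmul[OF curvature_op_lin2]
      inner_add_left sum.distrib sum_distrib_left)

lemma sharp_ricci: "y \<in> S \<Longrightarrow> g y (sharp g y (ricci g y v)) w = ricci g y v w"
  by (intro sharp_apply form linear_ricci)

lemma linear_sharp_ricci: "y \<in> S \<Longrightarrow> linear (\<lambda>v. sharp g y (ricci g y v))"
  by (rule linearI; rule form_eqI[of y])
    (simp_all add: sharp_ricci linear_add[OF lin1] linear_cmul[OF lin1]
      linear_add[OF linear_ricci1] linear_cmul[OF linear_ricci1])

end

text \<open>Inner product and curvature tensor at a point determine the scalar curvature by traces,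
  so \<open>\<phi>\<close> need not be the differential of a map. This is the obstruction to
  0-curvature homogeneity.\<close>

lemma scalar_curvature_linear_isometry:
  fixes \<phi> :: "'e::euclidean_space \<Rightarrow> 'e"
  assumes g: "metric_field S g" "y \<in> S" and g': "metric_field S' g'" "y' \<in> S'"
    and \<phi>: "linear \<phi>" "bij \<phi>" and iso: "\<And>u v. g' y' (\<phi> u) (\<phi> v) = g y u v"
    and R: "\<And>vs. length vs = 4 \<Longrightarrow> curvature_tensor g' y' (map \<phi> vs) = curvature_tensor g y vs"
  shows "local_scalar_curvature g' y' = local_scalar_curvature g y"
proof -
  interpret g: metric_field S g by (rule g(1))
  interpret g': metric_field S' g' by (rule g'(1))
  have eqI: "v = w" if "\<And>z. g' y' v (\<phi> z) = g' y' w (\<phi> z)" for v w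
  proof (rule g'.form_eqI[OF g'(2)])
    fix z
    obtain z' where "z = \<phi> z'" using bij_is_surj[OF \<phi>(2)] by (metis surjD)
    then show "g' y' v z = g' y' w z" using that by simp
  qed
  have op: "curvature_op g' y' (\<phi> u) (\<phi> v) (\<phi> w) = \<phi> (curvature_op g y u v w)" for u v w
  proof (rule eqI)
    fix z show "g' y' (curvature_op g' y' (\<phi> u) (\<phi> v) (\<phi> w)) (\<phi> z) = g' y' (\<phi> (curvature_op g y u v w)) (\<phi> z)"
      using R[of "[u, v, w, z]"] by (simp add: curvature_tensor_def iso numeral_eq_Suc)
  qed
  have ric: "ricci g' y' (\<phi> v) (\<phi> w) = ricci g y v w" for v w
    unfolding ricci_def 
    by (rule trace_conjugate[where A = "\<lambda>u. curvature_op g y u v w"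
          and A' = "\<lambda>u. curvature_op g' y' u (\<phi> v) (\<phi> w)", OF g.curvature_op_lin1[OF g(2)] \<phi> op])
  have "sharp g' y' (ricci g' y' (\<phi> v)) = \<phi> (sharp g y (ricci g y v))" for v
    by (rule eqI) (simp add: g'.sharp_ricci[OF g'(2)] iso g.sharp_ricci[OF g(2)] ric)
  then show ?thesis
    
    unfolding local_scalar_curvature_def
    by (rule trace_conjugate[where A = "\<lambda>b. sharp g y (ricci g y b)"
          and A' = "\<lambda>b. sharp g' y' (ricci g' y' b)", OF g.linear_sharp_ricci[OF g(2)] \<phi>])
qed

section \<open>The curvature of \<open>e\<^bsup>tx\<^esup>(dx\<^sup>2 + h)\<close>\<close>

text \<open>Coordinate form of the metric of the product; \<open>h\<close> stands for the metric of
  \<open>N\<close> in a chart.\<close>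

definition warp ::
  "real \<Rightarrow> ('e::euclidean_space \<Rightarrow> 'e \<Rightarrow> 'e \<Rightarrow> real) \<Rightarrow> real \<times> 'e \<Rightarrow> real \<times> 'e \<Rightarrow> real \<times> 'e \<Rightarrow> real" where
  "warp t h P u v = exp (t * fst P) * (fst u * fst v + h (snd P) (snd u) (snd v))"

lemma smooth_on_exp: "smooth_on UNIV (exp :: real \<Rightarrow> real)"
proof -
  have "C_k_on k UNIV (exp :: real \<Rightarrow> real)" for k
  proof (induction k)
    case (Suc k)
    show ?case
      by (rule C_k_on_SucI[where f' = "\<lambda>x v. exp x * v"])
        (auto intro!: derivative_eq_intros C_k_on_mult Suc C_k_on_const)
  qed (simp add: continuous_on_exp)
  then show ?thesis by (simp add: smooth_on_def)
qed

lemma smooth_on_exp_fst: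
  fixes S :: "(real \<times> 'e::euclidean_space) set"
  assumes "open S"
  shows "smooth_on S (\<lambda>P. exp (t * fst P))"
proof (rule smooth_on_compose[OF assms open_UNIV _ smooth_on_exp])
  show "smooth_on S (\<lambda>P. t * fst P)"
    by (intro smooth_on_linear assms linearI) (auto simp: algebra_simps)
qed auto

lemma smooth_on_snd_compose:
  fixes S :: "'e::euclidean_space set"
  assumes "open S" "smooth_on S f"
  shows "smooth_on ((UNIV :: real set) \<times> S) (\<lambda>P. f (snd P))"
proof (rule smooth_on_compose[OF _ assms(1) _ assms(2)])
  show "open ((UNIV :: real set) \<times> S)" using assms by (simp add: open_Times)
  then show "smooth_on ((UNIV :: real set) \<times> S) snd" by (intro smooth_on_linear linearI) auto
qed auto

lemma has_derivative_snd_compose: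
  assumes "f differentiable (at (snd P))"
  shows "((\<lambda>P. f (snd P)) has_derivative (\<lambda>u. fderiv f (snd P) (snd u))) (at P)"
  using diff_chain_at[OF has_derivative_snd[OF has_derivative_ident], OF has_fderiv[OF assms]]
  by (simp add: o_def)

context metric_field
begin

lemma open_cylinder: "open ((UNIV :: real set) \<times> S)"
  using open_S by (simp add: open_Times)

lemma nondeg_form_warp:
  assumes "snd P \<in> S"
  shows "nondeg_form (warp t g P)"
proof
  show "bilinear (warp t g P)"
    unfolding bilinear_def warp_def
    by (intro conjI allI linearI)
      (simp_all add: bilinear_ladd[OF bilin[OF assms]] bilinear_radd[OF bilin[OF assms]]
        bilinear_lmul[OF bilin[OF assms]] bilinear_rmul[OF bilin[OF assms]] algebra_simps)
  show "warp t g P u v = warp t g P v u" for u v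
    unfolding warp_def by (simp add: sym[OF assms, of "snd u"] mult.commute)
  show "\<exists>v. warp t g P u v \<noteq> 0" if "u \<noteq> 0" for u
  proof (cases "fst u = 0")
    case True
    then have "snd u \<noteq> 0" using that by (simp add: prod_eq_iff)
    then obtain v where "g (snd P) (snd u) v \<noteq> 0" using nondeg_form.nondegenerate[OF form[OF assms]] by blast
    then show ?thesis using True by (intro exI[of _ "(0, v)"]) (simp add: warp_def)
  next
    case False
    then show ?thesis by (intro exI[of _ "(1, 0)"]) (simp add: warp_def bilinear_rzero[OF bilin[OF assms]])
  qed
qed

lemma metric_field_warp: "metric_field ((UNIV :: real set) \<times> S) (warp t g)"
proof (rule metric_field.intro)
  show "open ((UNIV :: real set) \<times> S)" by (rule open_cylinder)
  show "nondeg_form (warp t g P)" if "P \<in> UNIV \<times> S" for P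
    using that by (intro nondeg_form_warp) auto
  show "smooth_on (UNIV \<times> S) (\<lambda>P. warp t g P u v)" for u v
    unfolding warp_def
    by (intro smooth_on_mult smooth_on_add smooth_on_exp_fst smooth_on_const open_cylinder
        smooth_on_snd_compose[OF open_S smooth])
qed

text \<open>When the Koszul forms for \<open>u, v, w\<close> and \<open>u, w, v\<close> are added,
  only the derivative along \<open>u\<close> survives.\<close>

lemma metric_compatible:
  assumes y: "y \<in> S"
  shows "fderiv (\<lambda>x. g x v w) y u = g y (christoffel g y u v) w + g y v (christoffel g y u w)"
  unfolding sym[OF y, of v] christoffel_koszul[OF y] koszul_def
  by (simp add: fderiv_sym[OF y, of w v] field_simps)

text \<open>This is the rule for a conformal change by \<open>exp (2 * f)\<close> of the product
  metric \<open>dx^2 + g\<close>, with \<open>f = t * x / 2\<close> of gradient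
  \<open>(t / 2, 0)\<close>. It is verified by pairing with \<open>z\<close>. The result does not
  involve the coordinate on the line.\<close>

lemma christoffel_warp:
  assumes P: "snd P \<in> S"
  shows "christoffel (warp t g) P u v =
    (t / 2 * (fst u * fst v - g (snd P) (snd u) (snd v)),
     (t / 2) *\<^sub>R (fst u *\<^sub>R snd v + fst v *\<^sub>R snd u) + christoffel g (snd P) (snd u) (snd v))"
    (is "_ = ?\<Gamma>")
  unfolding christoffel_sharp[of "warp t g"]
proof (rule sharp_eqI[where g = "warp t g" and y = P, OF nondeg_form_warp[OF P]])
  fix z
  have d: "fderiv (\<lambda>x. warp t g x v z) P u = exp (t * fst P) *
    (t * fst u * (fst v * fst z + g (snd P) (snd v) (snd z))
      + fderiv (\<lambda>x. g x (snd v) (snd z)) (snd P) (snd u))" for u v z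
  proof -
    have "((\<lambda>x. warp t g x v z) has_derivative
        (\<lambda>u. exp (t * fst P) * fderiv (\<lambda>x. g x (snd v) (snd z)) (snd P) (snd u)
          + exp (t * fst P) * (t * fst u) * (fst v * fst z + g (snd P) (snd v) (snd z)))) (at P)"
      unfolding warp_def
      by (auto intro!: derivative_eq_intros has_derivative_snd_compose[OF metric_differentiable[OF P]])
    from fun_cong[OF fderivI[OF this], of u] show ?thesis by (simp add: algebra_simps)
  qed
  have "warp t g P ?\<Gamma> z = exp (t * fst P) *
    (t / 2 * (fst u * fst v - g (snd P) (snd u) (snd v)) * fst z
      + t / 2 * (fst u * g (snd P) (snd v) (snd z) + fst v * g (snd P) (snd u) (snd z))
      + koszul g (snd P) (snd u) (snd v) (snd z))"
    unfolding warp_def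
    by (simp add: linear_add[OF lin1[OF P]] linear_cmul[OF lin1[OF P]] christoffel_koszul[OF P] algebra_simps)
  also have "\<dots> = koszul (warp t g) P u v z"
    unfolding koszul_def d by (simp add: field_simps)
  finally show "warp t g P ?\<Gamma> z = koszul (warp t g) P u v z" .
qed

text \<open>Only derivatives along \<open>N\<close> occur, as the symbols do not depend on
  \<open>fst P\<close>. From the curvature of \<open>g\<close> that of constant sectional curvature
  \<open>(t / 2)\<^sup>2\<close> is subtracted; the result vanishes as soon as one argument points
  along the line.\<close>

lemma curvature_op_warp:
  assumes P: "snd P \<in> S"
  shows "curvature_op (warp t g) P u v w =
    (0, curvature_op g (snd P) (snd u) (snd v) (snd w)
      + (t / 2)\<^sup>2 *\<^sub>R (g (snd P) (snd u) (snd w) *\<^sub>R snd v - g (snd P) (snd v) (snd w) *\<^sub>R snd u))"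
proof -
  have PS: "P \<in> UNIV \<times> S" using P by (cases P) auto
  define k where "k = t / 2"
  define \<Gamma> where "\<Gamma> = christoffel g (snd P)"
  let ?h = "g (snd P)"
  have d: "fderiv (\<lambda>x. christoffel (warp t g) x v w) P u =
      (- k * fderiv (\<lambda>x. g x (snd v) (snd w)) (snd P) (snd u),
       fderiv (\<lambda>x. christoffel g x (snd v) (snd w)) (snd P) (snd u))" for u v w
  proof -
    have "((\<lambda>P. (k * (fst v * fst w - g (snd P) (snd v) (snd w)),
         k *\<^sub>R (fst v *\<^sub>R snd w + fst w *\<^sub>R snd v) + christoffel g (snd P) (snd v) (snd w)))
       has_derivative (\<lambda>u. (- k * fderiv (\<lambda>x. g x (snd v) (snd w)) (snd P) (snd u),
         fderiv (\<lambda>x. christoffel g x (snd v) (snd w)) (snd P) (snd u)))) (at P)"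
      by (auto intro!: derivative_eq_intros has_derivative_snd_compose[OF metric_differentiable[OF P]]
          has_derivative_snd_compose[OF christoffel_differentiable[OF P]])
    then have "((\<lambda>x. christoffel (warp t g) x v w)
       has_derivative (\<lambda>u. (- k * fderiv (\<lambda>x. g x (snd v) (snd w)) (snd P) (snd u),
         fderiv (\<lambda>x. christoffel g x (snd v) (snd w)) (snd P) (snd u)))) (at P)"
      by (rule has_derivative_transform_within_open[OF _ open_cylinder PS])
        (auto simp: christoffel_warp k_def)
    from fun_cong[OF fderivI[OF this], of u] show ?thesis .
  qed
  have \<Gamma>w: "christoffel (warp t g) P u v =
    (k * (fst u * fst v - ?h (snd u) (snd v)),
     k *\<^sub>R (fst u *\<^sub>R snd v + fst v *\<^sub>R snd u) + \<Gamma> (snd u) (snd v))" for u v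
    by (simp add: christoffel_warp[OF P] k_def \<Gamma>_def)
  have lin\<Gamma>: "\<Gamma> u (v + w) = \<Gamma> u v + \<Gamma> u w" "\<Gamma> u (r *\<^sub>R v) = r *\<^sub>R \<Gamma> u v" for u v w r
    unfolding \<Gamma>_def by (simp_all add: linear_add[OF christoffel_lin2[OF P]] linear_cmul[OF christoffel_lin2[OF P]])
  have linh: "?h u (v + w) = ?h u v + ?h u w" "?h u (r *\<^sub>R v) = r * ?h u v" for u v w r
    by (simp_all add: linear_add[OF lin2[OF P]] linear_cmul[OF lin2[OF P]])
  have comp: "fderiv (\<lambda>x. g x v w) (snd P) u = ?h w (\<Gamma> u v) + ?h v (\<Gamma> u w)" for u v w
    unfolding metric_compatible[OF P] \<Gamma>_def by (simp add: sym[OF P])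
  have \<Gamma>sym: "\<Gamma> (snd v) (snd u) = \<Gamma> (snd u) (snd v)" "?h (snd v) (snd u) = ?h (snd u) (snd v)"
    unfolding \<Gamma>_def by (simp_all add: christoffel_sym[OF P, of "snd v"] sym[OF P, of "snd v"])
  \<comment> \<open>Terms of first order in \<open>k\<close> cancel by metric compatibility, in the
    form \<open>comp\<close>; those of second order are symmetric in \<open>u\<close> and
    \<open>v\<close>.\<close>
  have "fst (curvature_op (warp t g) P u v w) = 0"
    unfolding curvature_op_def d \<Gamma>w by (simp add: lin\<Gamma> linh comp \<Gamma>sym algebra_simps)
  moreover have "snd (curvature_op (warp t g) P u v w) =
      curvature_op g (snd P) (snd u) (snd v) (snd w)
      + k\<^sup>2 *\<^sub>R (?h (snd u) (snd w) *\<^sub>R snd v - ?h (snd v) (snd w) *\<^sub>R snd u)"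
    unfolding curvature_op_def d \<Gamma>w
    by (simp add: lin\<Gamma> linh \<Gamma>sym \<Gamma>_def[symmetric] algebra_simps power2_eq_square)
  ultimately show ?thesis by (simp add: prod_eq_iff k_def)
qed

text \<open>The line contributes nothing to the trace. With n the dimension of \<open>N\<close> and
  h the metric at \<open>snd P\<close>, the endomorphism of the model space of \<open>N\<close> that
  sends u to h(u,w) v - h(v,w) u has trace (1 - n) h(v,w).\<close>

lemma ricci_warp:
  assumes P: "snd P \<in> S"
  shows "ricci (warp t g) P v w =
    ricci g (snd P) (snd v) (snd w) - (t / 2)\<^sup>2 * (real DIM('e) - 1) * g (snd P) (snd v) (snd w)"
proof -
  have "(\<Sum>b\<in>Basis. g (snd P) b (snd w) * (snd v \<bullet> b)) = g (snd P) (snd v) (snd w)"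
    using linear_expansion[OF lin1[OF P], where w = "snd v"] by (simp add: mult.commute)
  moreover have "ricci (warp t g) P v w = ricci g (snd P) (snd v) (snd w)
      + (t / 2)\<^sup>2 * ((\<Sum>b\<in>Basis. g (snd P) b (snd w) * (snd v \<bullet> b))
        - (\<Sum>b\<in>(Basis :: 'e set). g (snd P) (snd v) (snd w)))"
    unfolding ricci_def sum_Basis_prod curvature_op_warp[OF P]
    by (simp add: inner_add_left inner_diff_left inner_prod_def sum.distrib sum_subtractf
        sum_distrib_left bilinear_lzero[OF bilin[OF P]] algebra_simps)
  ultimately show ?thesis by (simp add: algebra_simps)
qed

text \<open>Raising an index divides by the conformal factor. The Ricci correction becomes a
  multiple of the identity on the n directions along \<open>N\<close>, whose trace supplies the
  factor n.\<close>

lemma scalar_curvature_warp: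
  assumes P: "snd P \<in> S"
  shows "local_scalar_curvature (warp t g) P =
    exp (- t * fst P) * (local_scalar_curvature g (snd P) - real DIM('e) * (real DIM('e) - 1) / 4 * t\<^sup>2)"
proof -
  let ?c = "(t / 2)\<^sup>2 * (real DIM('e) - 1)"
  have sharp: "sharp (warp t g) P (ricci (warp t g) P v) =
      (0, exp (- t * fst P) *\<^sub>R (sharp g (snd P) (ricci g (snd P) (snd v)) - ?c *\<^sub>R snd v))" for v
    by (rule sharp_eqI[where g = "warp t g" and y = P, OF nondeg_form_warp[OF P]])
      (simp add: warp_def ricci_warp[OF P] linear_cmul[OF lin1[OF P]] linear_diff[OF lin1[OF P]]
        sharp_ricci[OF P] exp_minus)
  have "local_scalar_curvature (warp t g) P =
      sharp (warp t g) P (ricci (warp t g) P (1, 0)) \<bullet> (1, 0)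
      + (\<Sum>b\<in>(Basis :: 'e set). sharp (warp t g) P (ricci (warp t g) P (0, b)) \<bullet> (0, b))"
    unfolding local_scalar_curvature_def sum_Basis_prod by simp
  also have "\<dots> = (\<Sum>b\<in>(Basis :: 'e set). exp (- t * fst P) *
      (sharp g (snd P) (ricci g (snd P) b) \<bullet> b - ?c))"
    unfolding sharp by (simp add: inner_diff_left)
  also have "\<dots> = exp (- t * fst P) * (local_scalar_curvature g (snd P) - real DIM('e) * ?c)"
    unfolding local_scalar_curvature_def by (simp add: sum_distrib_left[symmetric] sum_subtractf)
  finally show ?thesis by (simp add: power2_eq_square field_simps)
qed

end

section \<open>Local expressions on manifolds\<close>

lemma fderiv_compose:
  assumes "F differentiable (at y)" "f differentiable (at (F y))"
  shows "fderiv (\<lambda>x. f (F x)) y u = fderiv f (F y) (fderiv F y u)"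
  using frechet_derivative_compose[OF assms] by (simp add: o_def)

lemma christoffel_cong:
  assumes "open S" "y \<in> S" "\<And>x. x \<in> S \<Longrightarrow> g x = g' x"
  shows "christoffel g y = christoffel g' y"
proof -
  have "fderiv (\<lambda>x. g x v w) y = fderiv (\<lambda>x. g' x v w) y" for v w
    by (rule fderiv_cong[OF assms(1,2)]) (simp add: assms(3))
  then show ?thesis unfolding christoffel_def[abs_def] sharp_def by (simp add: assms(2,3))
qed

text \<open>Curvature depends only on the germ of the metric. This is used to pass from the metric
  of the product in a chart to \<open>warp\<close>, with which it is identified on the chart
  image.\<close>

lemma nabla_curvature_cong:
  assumes S: "open S" and eq: "\<And>x. x \<in> S \<Longrightarrow> g x = g' x"
  shows "y \<in> S \<Longrightarrow> nabla_curvature l g y = nabla_curvature l g' y"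
proof (induction l arbitrary: y)
  case 0
  have \<Gamma>: "christoffel g x = christoffel g' x" if "x \<in> S" for x
    by (rule christoffel_cong[OF S that eq])
  have "fderiv (\<lambda>x. christoffel g x v w) y = fderiv (\<lambda>x. christoffel g' x v w) y" for v w
    by (rule fderiv_cong[OF S 0]) (simp add: \<Gamma>)
  then have "curvature_op g y u v w = curvature_op g' y u v w" for u v w
    unfolding curvature_op_def by (simp add: \<Gamma>[OF 0])
  then show ?case by (auto simp: curvature_tensor_def eq[OF 0])
next
  case (Suc l)
  have "fderiv (\<lambda>x. nabla_curvature l g x ws) y = fderiv (\<lambda>x. nabla_curvature l g' x ws) y" for ws
    by (rule fderiv_cong[OF S Suc.prems]) (simp add: Suc.IH)
  then show ?case
    by (auto simp: covariant_derivative_def Let_def christoffel_cong[OF S Suc.prems eq] Suc.IH[OF Suc.prems])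
qed

context smooth_manifold
begin

lemma openin_chart: "c \<in> atlas M \<Longrightarrow> openin (mtop M) (fst c)"
  using chart_domain by (cases c) auto

lemma chart_subset: "c \<in> atlas M \<Longrightarrow> fst c \<subseteq> points M"
  using openin_chart openin_subset by blast

lemma topspace_chart: "c \<in> atlas M \<Longrightarrow> topspace (subtopology (mtop M) (fst c)) = fst c"
  by (simp add: topspace_subtopology inf.absorb2 chart_subset)

lemma chart_homeomorphic:
  "c \<in> atlas M \<Longrightarrow> homeomorphic_map (subtopology (mtop M) (fst c)) (top_of_set (snd c ` fst c)) (snd c)"
  using chart_homeo[of "fst c" "snd c"] by simp

lemma inj_on_chart: "c \<in> atlas M \<Longrightarrow> inj_on (snd c) (fst c)"
  using homeomorphic_imp_injective_map[OF chart_homeomorphic] topspace_chart by metis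

lemma open_chart_image:
  assumes c: "c \<in> atlas M" and W: "openin (mtop M) W" "W \<subseteq> fst c"
  shows "open (snd c ` W)"
proof -
  have "openin (subtopology (mtop M) (fst c)) W" using W by (simp add: openin_open_subtopology openin_chart[OF c])
  then have "openin (top_of_set (snd c ` fst c)) (snd c ` W)"
    using homeomorphic_imp_open_map[OF chart_homeomorphic[OF c]] unfolding open_map_def by blast
  moreover have "open (snd c ` fst c)" using chart_image[of "fst c" "snd c"] c by simp
  ultimately show ?thesis using openin_open_trans by blast
qed

lemma chart_inv_chart: "c \<in> atlas M \<Longrightarrow> p \<in> fst c \<Longrightarrow> chart_inv c (snd c p) = p"
  by (simp add: inj_on_chart)

lemma chart_chart_inv: "y \<in> snd c ` W \<Longrightarrow> W \<subseteq> fst c \<Longrightarrow> snd c (chart_inv c y) = y"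
  by (meson f_inv_into_f image_mono subsetD)

lemma chart_inv_in: "c \<in> atlas M \<Longrightarrow> y \<in> snd c ` W \<Longrightarrow> W \<subseteq> fst c \<Longrightarrow> chart_inv c y \<in> W"
  using chart_inv_chart by fastforce

lemma chart_at_atlas: "p \<in> points M \<Longrightarrow> chart_at M p \<in> atlas M"
  and chart_at_mem: "p \<in> points M \<Longrightarrow> p \<in> fst (chart_at M p)"
proof -
  assume "p \<in> points M"
  then have "p \<in> (\<Union>c\<in>atlas M. fst c)" using chart_cover by simp
  then have "\<exists>c. c \<in> atlas M \<and> p \<in> fst c" by blast
  then have "chart_at M p \<in> atlas M \<and> p \<in> fst (chart_at M p)" unfolding chart_at_def by (rule someI_ex)
  then show "chart_at M p \<in> atlas M" "p \<in> fst (chart_at M p)" by auto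
qed

text \<open>The local expressions of the identity are the transition maps; changes of chart thus
  become a special case of isometries.\<close>

lemma smooth_map_id: "smooth_map M M (\<lambda>p. p)"
  unfolding smooth_map_def
proof (intro conjI ballI)
  fix c d assume "c \<in> atlas M" "d \<in> atlas M"
  then have "smooth_on (snd c ` (fst c \<inter> fst d)) (snd d \<circ> chart_inv c)"
    using chart_transition[of "fst c" "snd c" "fst d" "snd d"] by simp
  moreover have "fst c \<inter> fst d = {p \<in> fst c. p \<in> fst d}" by auto
  ultimately show "smooth_on (snd c ` {p \<in> fst c. p \<in> fst d}) (snd d \<circ> (\<lambda>p. p) \<circ> chart_inv c)"
    by (simp add: o_def)
qed simp

lemma differential_id:
  assumes p: "p \<in> points M"
  shows "differential M M (\<lambda>p. p) p = (\<lambda>u. u)"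
proof -
  let ?c = "chart_at M p"
  have c: "?c \<in> atlas M" and pc: "p \<in> fst ?c" using chart_at_atlas chart_at_mem p by auto
  have "fderiv (snd ?c \<circ> (\<lambda>p. p) \<circ> chart_inv ?c) (snd ?c p) = fderiv (\<lambda>y. y) (snd ?c p)"
    by (rule fderiv_cong[OF open_chart_image[OF c openin_chart[OF c] order_refl]])
      (use pc in \<open>auto simp: chart_inv_chart[OF c]\<close>)
  then show ?thesis by (simp add: differential_def)
qed

end

section \<open>Local expressions of maps and the chain rule\<close>

abbreviation expr_domain :: "('a \<Rightarrow> 'b) \<Rightarrow> ('a, 'e) chart \<Rightarrow> ('b, 'f) chart \<Rightarrow> 'e set" where
  "expr_domain f c d \<equiv> snd c ` {p \<in> fst c. f p \<in> fst d}"

abbreviation local_expr :: "('a \<Rightarrow> 'b) \<Rightarrow> ('a, 'e) chart \<Rightarrow> ('b, 'f) chart \<Rightarrow> 'e \<Rightarrow> 'f" where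
  "local_expr f c d \<equiv> snd d \<circ> f \<circ> chart_inv c"

locale manifold_map = M: smooth_manifold M + M': smooth_manifold M'
  for M :: "('a, 'e::euclidean_space) manifold" and M' :: "('b, 'f::euclidean_space) manifold" +
  fixes f :: "'a \<Rightarrow> 'b"
  assumes smooth_f: "smooth_map M M' f"
begin

lemma f_points: "p \<in> points M \<Longrightarrow> f p \<in> points M'"
  using smooth_f unfolding smooth_map_def continuous_map_def by auto

lemma open_expr_domain:
  assumes "c \<in> atlas M" "d \<in> atlas M'"
  shows "open (expr_domain f c d)"
proof (rule M.open_chart_image[OF assms(1)])
  show "openin (mtop M) {p \<in> fst c. f p \<in> fst d}"
    using smooth_f M.openin_chart[OF assms(1)] M'.openin_chart[OF assms(2)]
    by (intro openin_continuous_map_preimage_gen[of "mtop M" "mtop M'"]) (auto simp: smooth_map_def)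
qed auto

lemma smooth_local_expr: "c \<in> atlas M \<Longrightarrow> d \<in> atlas M' \<Longrightarrow> smooth_on (expr_domain f c d) (local_expr f c d)"
  using smooth_f unfolding smooth_map_def by blast

lemma differentiable_local_expr:
  "c \<in> atlas M \<Longrightarrow> d \<in> atlas M' \<Longrightarrow> y \<in> expr_domain f c d \<Longrightarrow> local_expr f c d differentiable (at y)"
  by (rule smooth_on_differentiable[OF smooth_local_expr])

end

lemma local_expr_compose:
  assumes f: "manifold_map M M' f" and h: "manifold_map M' M'' h"
    and c: "c \<in> atlas M" and d: "d \<in> atlas M'" and e: "e \<in> atlas M''"
    and p: "p \<in> fst c" "f p \<in> fst d" "h (f p) \<in> fst e"
  shows "fderiv (local_expr (h \<circ> f) c e) (snd c p) u =
    fderiv (local_expr h d e) (snd d (f p)) (fderiv (local_expr f c d) (snd c p) u)"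
proof -
  interpret f: manifold_map M M' f by (rule f)
  interpret h: manifold_map M' M'' h by (rule h)
  note inv = f.M.chart_inv_chart[OF c] f.M'.chart_inv_chart[OF d]
  have Fp: "local_expr f c d (snd c p) = snd d (f p)" by (simp add: inv p)
  have diff: "local_expr f c d differentiable (at (snd c p))"
    "local_expr h d e differentiable (at (local_expr f c d (snd c p)))"
    unfolding Fp using p
    by (auto intro!: f.differentiable_local_expr[OF c d] h.differentiable_local_expr[OF d e] imageI)
  have "fderiv (local_expr (h \<circ> f) c e) (snd c p) =
      fderiv (\<lambda>x. local_expr h d e (local_expr f c d x)) (snd c p)"
    by (rule fderiv_cong[OF f.open_expr_domain[OF c d]]) (use p in \<open>auto simp: inv\<close>)
  then show ?thesis by (simp only: fderiv_compose[OF diff] Fp)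
qed

context smooth_manifold
begin

lemma manifold_map_id: "manifold_map M M (\<lambda>p. p)"
  by unfold_locales (rule smooth_map_id)

text \<open>Recasts \<open>chart_vector\<close> as the derivative of a transition map into the
  preferred chart, so that \<open>local_expr_compose\<close> applies to it.\<close>

lemma chart_vector_local_expr:
  "c \<in> atlas M \<Longrightarrow> p \<in> fst c \<Longrightarrow>
    chart_vector M c (snd c p) = fderiv (local_expr (\<lambda>p. p) c (chart_at M p)) (snd c p)"
  by (simp add: chart_vector_def chart_inv_chart o_def)

lemma chart_vector_inverse:
  assumes c: "c \<in> atlas M" and p: "p \<in> fst c"
  shows "chart_vector M c (snd c p) (fderiv (local_expr (\<lambda>p. p) (chart_at M p) c) (snd (chart_at M p) p) u) = u"
    and "fderiv (local_expr (\<lambda>p. p) (chart_at M p) c) (snd (chart_at M p) p) (chart_vector M c (snd c p) u) = u"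
proof -
  have pM: "p \<in> points M" using chart_subset c p by blast
  let ?a = "chart_at M p"
  have a: "?a \<in> atlas M" and pa: "p \<in> fst ?a" using chart_at_atlas chart_at_mem pM by auto
  have loc: "fderiv (local_expr (\<lambda>p. p) d d) (snd d p) = (\<lambda>u. u)" if d: "d \<in> atlas M" and pd: "p \<in> fst d" for d
  proof -
    have "fderiv (local_expr (\<lambda>p. p) d d) (snd d p) = fderiv (\<lambda>y. y) (snd d p)"
      by (rule fderiv_cong[OF open_chart_image[OF d openin_chart[OF d] order_refl]])
        (use pd in \<open>auto simp: chart_inv_chart[OF d]\<close>)
    then show ?thesis by simp
  qed
  show "chart_vector M c (snd c p) (fderiv (local_expr (\<lambda>p. p) ?a c) (snd ?a p) u) = u"
    using local_expr_compose[OF manifold_map_id manifold_map_id a c a pa p pa, of u] loc[OF a pa]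
    by (simp add: chart_vector_local_expr[OF c p] o_def)
  show "fderiv (local_expr (\<lambda>p. p) ?a c) (snd ?a p) (chart_vector M c (snd c p) u) = u"
    using local_expr_compose[OF manifold_map_id manifold_map_id c a c p pa p, of u] loc[OF c p]
    by (simp add: chart_vector_local_expr[OF c p] o_def)
qed

lemma linear_chart_vector:
  assumes c: "c \<in> atlas M" and p: "p \<in> fst c"
  shows "linear (chart_vector M c (snd c p))"
proof -
  interpret manifold_map M M "\<lambda>p. p" by (rule manifold_map_id)
  have pM: "p \<in> points M" using chart_subset c p by blast
  show ?thesis
    unfolding chart_vector_local_expr[OF c p]
    by (rule linear_frechet_derivative[OF differentiable_local_expr[OF c chart_at_atlas[OF pM]]])
      (use p chart_at_mem[OF pM] in auto)
qed

end

text \<open>Both sides are the derivative of one local expression of \<open>f\<close>, from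
  \<open>c\<close> into the preferred chart at \<open>f p\<close>, factored once through
  \<open>d\<close> and once through the preferred chart at \<open>p\<close>.\<close>

lemma (in manifold_map) chart_vector_local_expr_map:
  assumes c: "c \<in> atlas M" and d: "d \<in> atlas M'" and p: "p \<in> fst c" "f p \<in> fst d"
  shows "chart_vector M' d (snd d (f p)) (fderiv (local_expr f c d) (snd c p) u) =
    differential M M' f p (chart_vector M c (snd c p) u)"
proof -
  have pM: "p \<in> points M" using M.chart_subset c p by blast
  have f: "manifold_map M M' f" by unfold_locales
  let ?a = "chart_at M p" and ?b = "chart_at M' (f p)"
  have a: "?a \<in> atlas M" "p \<in> fst ?a" and b: "?b \<in> atlas M'" "f p \<in> fst ?b"
    using M.chart_at_atlas M.chart_at_mem M'.chart_at_atlas M'.chart_at_mem pM f_points by auto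
  have "chart_vector M' d (snd d (f p)) (fderiv (local_expr f c d) (snd c p) u) =
      fderiv (local_expr ((\<lambda>p. p) \<circ> f) c ?b) (snd c p) u"
    unfolding M'.chart_vector_local_expr[OF d p(2)]
    by (rule local_expr_compose[OF f M'.manifold_map_id c d b(1) p b(2), symmetric])
  also have "\<dots> = fderiv (local_expr (f \<circ> (\<lambda>p. p)) c ?b) (snd c p) u" by (simp add: o_def)
  also have "\<dots> = differential M M' f p (chart_vector M c (snd c p) u)"
    unfolding M.chart_vector_local_expr[OF c p(1)] differential_def
    by (rule local_expr_compose[OF M.manifold_map_id f c a(1) b(1) p(1) a(2) b(2)])
  finally show ?thesis .
qed

section \<open>Metrics in charts and independence of the chart\<close>

context pseudo_riemannian_manifold
begin

lemma metric_field_local_metric: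
  assumes c: "c \<in> atlas M"
  shows "metric_field (snd c ` fst c) (local_metric M g c)"
proof (rule metric_field.intro)
  show "open (snd c ` fst c)" by (rule open_chart_image[OF c openin_chart[OF c] order_refl])
  show "smooth_on (snd c ` fst c) (\<lambda>y. local_metric M g c y u v)" for u v by (rule metric_smooth[OF c])
  fix y assume "y \<in> snd c ` fst c"
  then obtain p where p: "p \<in> fst c" and y: "y = snd c p" by blast
  have pM: "p \<in> points M" using chart_subset c p by blast
  let ?T = "chart_vector M c y"
  have lm: "local_metric M g c y u v = g p (?T u) (?T v)" for u v
    unfolding local_metric_def y chart_inv_chart[OF c p] ..
  have T: "linear ?T" unfolding y by (rule linear_chart_vector[OF c p])
  note b = metric_bilinear[OF pM]
  show "nondeg_form (local_metric M g c y)"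
  proof
    show "bilinear (local_metric M g c y)"
      unfolding bilinear_def lm
      by (intro conjI allI linearI)
        (simp_all add: linear_add[OF T] linear_cmul[OF T] bilinear_ladd[OF b] bilinear_radd[OF b]
          bilinear_lmul[OF b] bilinear_rmul[OF b])
    show "local_metric M g c y u v = local_metric M g c y v u" for u v
      unfolding lm by (rule metric_symmetric[OF pM])
    fix u :: 'e assume "u \<noteq> 0"
    then have "?T u \<noteq> 0"
      using chart_vector_inverse(2)[OF c p, of u] chart_vector_inverse(2)[OF c p, of 0] linear_0[OF T] y by metis
    then obtain v where "g p (?T u) v \<noteq> 0" using metric_nondegenerate[OF pM] by blast
    \<comment> \<open>The witness is the preimage of \<open>v\<close> under \<open>?T\<close>, given
      by the transition from the preferred chart back to \<open>c\<close>.\<close>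
    then show "\<exists>v. local_metric M g c y u v \<noteq> 0"
      unfolding lm using chart_vector_inverse(1)[OF c p, of v] y by metis
  qed
qed

lemma local_homothety_isometry:
  assumes f: "smooth_map M M f"
    and iso: "\<And>p u v. p \<in> points M \<Longrightarrow> g (f p) (differential M M f p u) (differential M M f p v) = g p u v"
    and c: "c \<in> atlas M" and d: "d \<in> atlas M"
  shows "local_homothety (expr_domain f c d) (local_metric M g c) (snd d ` fst d) (local_metric M g d)
    (local_expr f c d) 1"
proof -
  interpret f: manifold_map M M f by unfold_locales (rule f)
  interpret c: metric_field "snd c ` fst c" "local_metric M g c" by (rule metric_field_local_metric[OF c])
  have sub: "expr_domain f c d \<subseteq> snd c ` fst c" by auto
  have "metric_field (expr_domain f c d) (local_metric M g c)"
    by (rule metric_field.intro[OF f.open_expr_domain[OF c d] _ smooth_on_subset[OF c.smooth sub]])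
      (use c.form in blast)
  moreover have "local_homothety_axioms (expr_domain f c d) (local_metric M g c) (snd d ` fst d)
      (local_metric M g d) (local_expr f c d) 1"
  proof (rule local_homothety_axioms.intro)
    show "smooth_on (expr_domain f c d) (local_expr f c d)" by (rule f.smooth_local_expr[OF c d])
    fix y assume "y \<in> expr_domain f c d"
    then obtain p where p: "p \<in> fst c" "f p \<in> fst d" and y: "y = snd c p" by blast
    have pM: "p \<in> points M" using chart_subset c p by blast
    have F: "local_expr f c d y = snd d (f p)" by (simp add: y chart_inv_chart[OF c p(1)])
    show "local_expr f c d y \<in> snd d ` fst d" unfolding F using p by blast
    show "local_metric M g d (local_expr f c d y) (fderiv (local_expr f c d) y u) (fderiv (local_expr f c d) y v)
        = 1 * local_metric M g c y u v" for u v
      unfolding F unfolding local_metric_def y chart_inv_chart[OF d p(2)] chart_inv_chart[OF c p(1)]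
        f.chart_vector_local_expr_map[OF c d p] by (simp add: iso[OF pM])
  qed simp
  ultimately show ?thesis by (intro local_homothety.intro metric_field_local_metric d)
qed

lemma local_scalar_curvature_isometry:
  assumes f: "smooth_map M M f"
    and iso: "\<And>p u v. p \<in> points M \<Longrightarrow> g (f p) (differential M M f p u) (differential M M f p v) = g p u v"
    and c: "c \<in> atlas M" and d: "d \<in> atlas M" and p: "p \<in> fst c" "f p \<in> fst d"
  shows "local_scalar_curvature (local_metric M g d) (snd d (f p)) =
    local_scalar_curvature (local_metric M g c) (snd c p)"
proof -
  interpret h: local_homothety "expr_domain f c d" "local_metric M g c" "snd d ` fst d" "local_metric M g d"
    "local_expr f c d" 1 by (rule local_homothety_isometry[OF f iso c d])
  have y: "snd c p \<in> expr_domain f c d" using p by blast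
  have F: "local_expr f c d (snd c p) = snd d (f p)" by (simp add: chart_inv_chart[OF c p(1)])
  show ?thesis
    using h.nabla_curvature_transform[OF y, of _ 0] h.F_metric[OF y] h.inj_J[OF y] h.surj_J[OF y] p
    unfolding F
    by (intro scalar_curvature_linear_isometry[OF h.src.metric_field_axioms y h.tgt.metric_field_axioms _
          h.linear_J[OF y]]) (auto simp: bij_def)
qed

text \<open>Invariance under the identity map, read in two charts.\<close>

lemma scalar_curvature_chart:
  assumes "c \<in> atlas M" "p \<in> fst c"
  shows "local_scalar_curvature (local_metric M g c) (snd c p) = scalar_curvature M g p"
proof -
  have p: "p \<in> points M" using chart_subset assms by blast
  show ?thesis unfolding scalar_curvature_def
    by (rule local_scalar_curvature_isometry[where f = "\<lambda>p. p", OF smooth_map_id])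
      (use assms p chart_at_atlas chart_at_mem differential_id in auto)
qed

lemma scalar_curvature_isometry:
  assumes "isometry M g f" "p \<in> points M"
  shows "scalar_curvature M g (f p) = scalar_curvature M g p"
proof -
  have f: "smooth_map M M f" "f p \<in> points M" using assms by (auto simp: isometry_def bij_betw_def)
  show ?thesis unfolding scalar_curvature_def
    by (rule local_scalar_curvature_isometry[OF f(1)])
      (use assms f chart_at_atlas chart_at_mem in \<open>auto simp: isometry_def\<close>)
qed

end

section \<open>The product with the real line\<close>

text \<open>As \<open>real_line\<close> has a single chart, these are all the charts of the
  product.\<close>

definition cylinder_chart :: "('a, 'e) chart \<Rightarrow> (real \<times> 'a, real \<times> 'e) chart" where
  "cylinder_chart c = (UNIV \<times> fst c, map_prod (\<lambda>x. x) (snd c))"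

lemma atlas_M_space: "atlas (M_space M) = cylinder_chart ` atlas M"
  unfolding product_manifold_def real_line_def cylinder_chart_def image_def
  by (auto; metis fst_conv snd_conv)

lemma points_M_space: "points (M_space M) = UNIV \<times> points M"
  by (simp add: product_manifold_def real_line_def topspace_prod_topology)

lemma chart_at_real_line: "chart_at real_line x = (UNIV, \<lambda>x. x)"
  unfolding chart_at_def by (rule some_equality) (auto simp: real_line_def)

lemma multilinear_map_scale:
  fixes T :: "'a::real_vector list \<Rightarrow> real"
  shows "multilinear n T \<Longrightarrow> length vs = n \<Longrightarrow> T (map (\<lambda>v. s *\<^sub>R v) vs) = s ^ n * T vs"
proof (induction n arbitrary: T vs)
  case (Suc n)
  obtain v ws where vs: "vs = v # ws" and ws: "length ws = n" using Suc.prems(2) by (cases vs) auto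
  let ?sws = "map (\<lambda>v. s *\<^sub>R v) ws"
  have "linear (\<lambda>w. T (w # ?sws))"
    using multilinear_update[OF Suc.prems(1), of "v # ?sws" 0] ws by simp
  from linear_cmul[OF this, of s v] have "T (s *\<^sub>R v # ?sws) = s * T (v # ?sws)" by simp
  also have "\<dots> = s * (s ^ n * T (v # ws))"
    using Suc.IH[OF multilinear_Cons[OF Suc.prems(1)] ws] by simp
  finally show ?case by (simp add: vs)
qed simp

text \<open>The formula for the derivative serves a second time, with \<open>r = 0\<close> and a
  transition map for \<open>F\<close>, to describe changes of chart on the product.\<close>

lemma local_homothety_warp:
  assumes "local_homothety S h S' h' F 1"
  shows "local_homothety (UNIV \<times> S) (warp t h) (UNIV \<times> S') (warp t h')
    (\<lambda>z. (fst z + r, F (snd z))) (exp (t * r))"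
    and "\<And>z. snd z \<in> S \<Longrightarrow> fderiv (\<lambda>z. (fst z + r, F (snd z))) z = (\<lambda>u. (fst u, fderiv F (snd z) (snd u)))"
proof -
  interpret local_homothety S h S' h' F 1 by (rule assms)
  show d: "fderiv (\<lambda>z. (fst z + r, F (snd z))) z = (\<lambda>u. (fst u, fderiv F (snd z) (snd u)))"
    if "snd z \<in> S" for z
    by (rule fderivI)
      (auto intro!: derivative_eq_intros has_derivative_snd_compose smooth_on_differentiable[OF F_smooth that])
  show "local_homothety (UNIV \<times> S) (warp t h) (UNIV \<times> S') (warp t h')
    (\<lambda>z. (fst z + r, F (snd z))) (exp (t * r))"
  proof (intro local_homothety.intro local_homothety_axioms.intro src.metric_field_warp tgt.metric_field_warp)
    show "smooth_on (UNIV \<times> S) (\<lambda>z. (fst z + r, F (snd z)))"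
    proof (intro smooth_on_Pair smooth_on_add smooth_on_const smooth_on_snd_compose
        src.open_cylinder src.open_S F_smooth)
      show "smooth_on (UNIV \<times> S) (fst :: real \<times> 'a \<Rightarrow> real)"
        by (intro smooth_on_linear src.open_cylinder linearI) auto
    qed
    fix z :: "real \<times> 'a" assume z: "z \<in> UNIV \<times> S"
    then have zS: "snd z \<in> S" by auto
    show "(fst z + r, F (snd z)) \<in> UNIV \<times> S'" using F_maps[OF zS] by simp
    show "warp t h' (fst z + r, F (snd z)) (fderiv (\<lambda>z. (fst z + r, F (snd z))) z u)
        (fderiv (\<lambda>z. (fst z + r, F (snd z))) z v) = exp (t * r) * warp t h z u v" for u v
      unfolding d[OF zS] by (simp add: warp_def F_metric[OF zS] distrib_left exp_add)
  qed simp
qed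

context smooth_manifold
begin

text \<open>The preferred chart of the product is chosen independently of that of \<open>M\<close>,
  so it is only known to be the cylinder over some chart around \<open>snd P\<close>.\<close>

lemma chart_at_M_space:
  assumes "snd P \<in> points M"
  obtains c where "c \<in> atlas M" "snd P \<in> fst c" "chart_at (M_space M) P = cylinder_chart c"
proof -
  have "cylinder_chart (chart_at M (snd P)) \<in> atlas (M_space M) \<and> P \<in> fst (cylinder_chart (chart_at M (snd P)))"
    using chart_at_atlas[OF assms] chart_at_mem[OF assms]
    by (cases P) (auto simp: atlas_M_space cylinder_chart_def)
  then have "chart_at (M_space M) P \<in> atlas (M_space M) \<and> P \<in> fst (chart_at (M_space M) P)"
    unfolding chart_at_def[of "M_space M"] by (rule someI)
  then show thesis using that by (auto simp: atlas_M_space cylinder_chart_def)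
qed

lemma chart_inv_cylinder_chart:
  assumes c: "c \<in> atlas M" and z: "snd z \<in> snd c ` fst c"
  shows "chart_inv (cylinder_chart c) z = (fst z, chart_inv c (snd z))"
proof (rule inv_into_f_eq)
  show "inj_on (snd (cylinder_chart c)) (fst (cylinder_chart c))"
    using inj_on_chart[OF c] by (auto simp: cylinder_chart_def inj_on_def)
  show "(fst z, chart_inv c (snd z)) \<in> fst (cylinder_chart c)"
    using z chart_inv_in[OF c] by (auto simp: cylinder_chart_def)
  show "snd (cylinder_chart c) (fst z, chart_inv c (snd z)) = z"
    using chart_chart_inv[OF z] by (simp add: cylinder_chart_def)
qed

lemma open_cylinder_image: "c \<in> atlas M \<Longrightarrow> open ((UNIV :: real set) \<times> snd c ` fst c)"
  using open_chart_image[OF _ openin_chart order_refl] by (simp add: open_Times)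

lemma differential_fst:
  assumes c: "c \<in> atlas M" and P: "snd P \<in> fst c" and chart: "chart_at (M_space M) P = cylinder_chart c"
  shows "differential (M_space M) real_line fst P = fst"
proof -
  have "fderiv (\<lambda>z. fst (chart_inv (cylinder_chart c) z)) (fst P, snd c (snd P)) =
      fderiv fst (fst P, snd c (snd P))"
    by (rule fderiv_cong[OF open_cylinder_image[OF c]])
      (use P chart_inv_cylinder_chart[OF c] in auto)
  also have "\<dots> = fst" by (rule fderivI) (auto intro!: derivative_eq_intros)
  finally show ?thesis
    by (simp add: differential_def chart chart_at_real_line cylinder_chart_def o_def map_prod_def split_beta)
qed

text \<open>The source is read in \<open>c\<close>, the target in the preferred chart of
  \<open>M\<close> at \<open>snd P\<close>; \<open>chart_vector\<close> is the derivative of the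
  transition between them.\<close>

lemma differential_snd:
  assumes c: "c \<in> atlas M" and P: "snd P \<in> fst c" and chart: "chart_at (M_space M) P = cylinder_chart c"
  shows "differential (M_space M) M snd P = (\<lambda>u. chart_vector M c (snd c (snd P)) (snd u))"
proof -
  interpret manifold_map M M "\<lambda>p. p" by (rule manifold_map_id)
  let ?a = "chart_at M (snd P)" and ?z = "(fst P, snd c (snd P))"
  have pM: "snd P \<in> points M" using chart_subset c P by blast
  have "fderiv (\<lambda>z. snd ?a (snd (chart_inv (cylinder_chart c) z))) ?z =
      fderiv (\<lambda>z. local_expr (\<lambda>p. p) c ?a (snd z)) ?z"
    by (rule fderiv_cong[OF open_cylinder_image[OF c]])
      (use P chart_inv_cylinder_chart[OF c] in auto)
  also have "\<dots> = (\<lambda>u. fderiv (local_expr (\<lambda>p. p) c ?a) (snd ?z) (snd u))"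
    by (rule fderivI, rule has_derivative_snd_compose, rule differentiable_local_expr[OF c chart_at_atlas[OF pM]])
      (use P chart_at_mem[OF pM] in auto)
  finally show ?thesis
    by (simp add: differential_def chart cylinder_chart_def chart_vector_local_expr[OF c P]
        o_def map_prod_def split_beta)
qed

end

context pseudo_riemannian_manifold
begin

lemma M_metric_warp:
  assumes "c \<in> atlas M" "snd P \<in> fst c" "chart_at (M_space M) P = cylinder_chart c"
  shows "M_metric t M g P = warp t (local_metric M g c) (fst P, snd c (snd P))"
  by (intro ext) (simp add: M_metric_def warp_def differential_fst[OF assms] differential_snd[OF assms]
      local_metric_def chart_inv_chart[OF assms(1,2)])

text \<open>The point with coordinates \<open>z\<close> has a preferred chart over some
  \<open>d\<close> that may differ from \<open>c\<close>. The transition between the two cylinders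
  is the identity of the line times a transition map of \<open>M\<close>, and the latter carries one
  local metric to the other.\<close>

lemma local_metric_M_space:
  assumes c: "c \<in> atlas M" and z: "snd z \<in> snd c ` fst c"
  shows "local_metric (M_space M) (M_metric t M g) (cylinder_chart c) z = warp t (local_metric M g c) z"
proof -
  obtain p where p: "p \<in> fst c" and zp: "snd z = snd c p" using z by blast
  have pM: "p \<in> points M" using chart_subset c p by blast
  let ?Q = "(fst z, p)"
  have Q: "chart_inv (cylinder_chart c) z = ?Q"
    using chart_inv_cylinder_chart[OF c z] zp chart_inv_chart[OF c p] by simp
  obtain d where d: "d \<in> atlas M" "snd ?Q \<in> fst d" "chart_at (M_space M) ?Q = cylinder_chart d"
    using chart_at_M_space[of ?Q] pM by auto
  interpret h: local_homothety "expr_domain (\<lambda>p. p) c d" "local_metric M g c" "snd d ` fst d"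
      "local_metric M g d" "local_expr (\<lambda>p. p) c d" 1
    by (rule local_homothety_isometry[OF smooth_map_id _ c d(1)]) (simp add: differential_id)
  let ?E = "local_expr (\<lambda>p. p) c d"
  have y: "snd z \<in> expr_domain (\<lambda>p. p) c d" using zp p d(2) by auto
  \<comment> \<open>The summand \<open>0\<close> gives the map the shape of
    \<open>local_homothety_warp\<close> with \<open>r = 0\<close>.\<close>
  have "fderiv (snd (cylinder_chart d) \<circ> chart_inv (cylinder_chart c)) z = fderiv (\<lambda>z. (fst z + 0, ?E (snd z))) z"
  proof (rule fderiv_cong)
    show "open ((UNIV :: real set) \<times> expr_domain (\<lambda>p. p) c d)" using h.src.open_S by (simp add: open_Times)
    show "z \<in> UNIV \<times> expr_domain (\<lambda>p. p) c d" using y by (cases z) auto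
    fix x assume x: "x \<in> (UNIV :: real set) \<times> expr_domain (\<lambda>p. p) c d"
    then have "snd x \<in> snd c ` fst c" by auto
    then show "(snd (cylinder_chart d) \<circ> chart_inv (cylinder_chart c)) x = (fst x + 0, ?E (snd x))"
      by (simp add: chart_inv_cylinder_chart[OF c]) (simp add: cylinder_chart_def)
  qed
  then have cv: "chart_vector (M_space M) (cylinder_chart c) z = (\<lambda>u. (fst u, fderiv ?E (snd z) (snd u)))"
    unfolding chart_vector_def Q d(3)
    by (rule trans[OF _ local_homothety_warp(2)[OF h.local_homothety_axioms y]])
  have E: "?E (snd z) = snd d p" by (simp add: zp chart_inv_chart[OF c p])
  show ?thesis
    unfolding local_metric_def[of "M_space M"] Q cv M_metric_warp[OF d]
    using h.F_metric[OF y] by (intro ext) (simp add: warp_def E[symmetric])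
qed

lemma nabla_R_M_space:
  assumes c: "c \<in> atlas M" "snd P \<in> fst c" "chart_at (M_space M) P = cylinder_chart c"
  shows "nabla_R (M_space M) (M_metric t M g) l P =
    nabla_curvature l (warp t (local_metric M g c)) (fst P, snd c (snd P))"
proof -
  have "nabla_R (M_space M) (M_metric t M g) l P =
      nabla_curvature l (local_metric (M_space M) (M_metric t M g) (cylinder_chart c)) (fst P, snd c (snd P))"
    unfolding nabla_R_def c(3) by (simp add: cylinder_chart_def map_prod_def split_beta)
  also have "\<dots> = nabla_curvature l (warp t (local_metric M g c)) (fst P, snd c (snd P))"
    by (rule nabla_curvature_cong[OF open_cylinder_image[OF c(1)] local_metric_M_space[OF c(1)]])
      (use c(2) in auto)
  finally show ?thesis .
qed

lemma homothety_nabla_R: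
  assumes f: "isometry M g f" and P: "snd P \<in> points M" and Q: "snd Q = f (snd P)"
  shows "\<exists>\<phi> (s::real). linear_isometry (M_metric t M g) P Q \<phi> \<and> s \<noteq> 0 \<and>
    (\<forall>l vs. length vs = l + 4 \<longrightarrow>
      nabla_R (M_space M) (M_metric t M g) l Q (map \<phi> vs) =
      s powi (- int l - 2) * nabla_R (M_space M) (M_metric t M g) l P vs)"
proof -
  have f': "smooth_map M M f" "snd Q \<in> points M"
    "\<And>p u v. p \<in> points M \<Longrightarrow> g (f p) (differential M M f p u) (differential M M f p v) = g p u v"
    using f P Q by (auto simp: isometry_def bij_betw_def)
  obtain c where c: "c \<in> atlas M" "snd P \<in> fst c" "chart_at (M_space M) P = cylinder_chart c"
    using chart_at_M_space[OF P] .
  obtain d where d: "d \<in> atlas M" "snd Q \<in> fst d" "chart_at (M_space M) Q = cylinder_chart d"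
    using chart_at_M_space[OF f'(2)] .
  define r where "r = fst Q - fst P"
  define F where "F = (\<lambda>z. (fst z + r, local_expr f c d (snd z)))"
  define zP where "zP = (fst P, snd c (snd P))"
  define zQ where "zQ = (fst Q, snd d (snd Q))"
  interpret h: local_homothety "UNIV \<times> expr_domain f c d" "warp t (local_metric M g c)"
      "UNIV \<times> snd d ` fst d" "warp t (local_metric M g d)" F "exp (t * r)"
    unfolding F_def by (rule local_homothety_warp(1)[OF local_homothety_isometry[OF f'(1,3) c(1) d(1)]])
  have zP: "zP \<in> UNIV \<times> expr_domain f c d" using c(2) d(2) Q by (auto simp: zP_def)
  have F: "F zP = zQ" by (simp add: F_def zP_def zQ_def r_def Q chart_inv_chart[OF c(1,2)])
  \<comment> \<open>The square root of the homothety factor, because the metric takes two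
    arguments.\<close>
  define s where "s = exp (t * r / 2)"
  have s: "s > 0" and s2: "exp (t * r) = s\<^sup>2" by (auto simp: s_def exp_double[symmetric])
  define J where "J = fderiv F zP"
  define \<phi> where "\<phi> = (\<lambda>u. inverse s *\<^sub>R J u)"
  have linJ: "linear J" "inj J" "surj J" unfolding J_def using h.linear_J h.inj_J h.surj_J zP by auto
  have lin: "linear \<phi>" unfolding \<phi>_def by (rule linear_compose_scale_right[OF linJ(1)])
  have "inj \<phi>" using linJ(2) s by (auto simp: \<phi>_def inj_def)
  then have bij: "bij \<phi>" using lin by (simp add: bij_def linear_injective_imp_surjective)
  have metric: "M_metric t M g P = warp t (local_metric M g c) zP" "M_metric t M g Q = warp t (local_metric M g d) zQ"
    unfolding zP_def zQ_def by (rule M_metric_warp[OF c], rule M_metric_warp[OF d])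
  have zQ: "zQ \<in> UNIV \<times> snd d ` fst d" using d(2) by (auto simp: zQ_def)
  have "M_metric t M g Q (\<phi> u) (\<phi> v) = M_metric t M g P u v" for u v
    unfolding metric \<phi>_def
    using h.F_metric[OF zP, of u v, unfolded F s2, folded J_def] s
    by (simp add: bilinear_lmul[OF h.tgt.bilin[OF zQ]] bilinear_rmul[OF h.tgt.bilin[OF zQ]]
        power2_eq_square) (simp add: field_simps)
  then have iso: "linear_isometry (M_metric t M g) P Q \<phi>" by (simp add: linear_isometry_def lin bij)
  have "nabla_R (M_space M) (M_metric t M g) l Q (map \<phi> vs) =
      s powi (- int l - 2) * nabla_R (M_space M) (M_metric t M g) l P vs" if len: "length vs = l + 4" for l vs
  proof -
    let ?T = "nabla_curvature l (warp t (local_metric M g d)) zQ"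
    have "multilinear (l + 4) ?T"
      using h.tgt.tensor_field_nabla_curvature zQ unfolding tensor_field_def by blast
    \<comment> \<open>Each of the \<open>l + 4\<close> arguments brings \<open>inverse s\<close>,
      and the transformation law brings \<open>s\<^sup>2\<close>; together they give the exponent
      \<open>- l - 2\<close>.\<close>
    then have "?T (map \<phi> vs) = inverse s ^ (l + 4) * ?T (map J vs)"
      using multilinear_map_scale[of "l + 4" ?T "map J vs" "inverse s"] len by (simp add: \<phi>_def o_def)
    also have "?T (map J vs) = s\<^sup>2 * nabla_curvature l (warp t (local_metric M g c)) zP vs"
      using h.nabla_curvature_transform[OF zP len] unfolding F J_def s2 .
    also have "inverse s ^ (l + 4) * (s\<^sup>2 * nabla_curvature l (warp t (local_metric M g c)) zP vs) =
        inverse (s ^ (l + 2)) * nabla_curvature l (warp t (local_metric M g c)) zP vs"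
    proof -
      have "l + 4 = (l + 2) + 2" by simp
      then have "inverse s ^ (l + 4) = inverse (s ^ (l + 2)) * inverse (s\<^sup>2)"
        by (simp only: power_add[of _ "l + 2" 2] power_inverse)
      then have "inverse s ^ (l + 4) * s\<^sup>2 = inverse (s ^ (l + 2))" using s by simp
      then show ?thesis unfolding mult.assoc[symmetric] by (rule arg_cong)
    qed
    also have "inverse (s ^ (l + 2)) = s powi (- int l - 2)"
    proof -
      have "- int l - 2 = - int (l + 2)" by simp
      then show ?thesis by (simp only: power_int_minus power_int_of_nat)
    qed
    finally show ?thesis
      unfolding nabla_R_M_space[OF c] nabla_R_M_space[OF d] zP_def zQ_def .
  qed
  then show ?thesis using iso s by (intro exI[of _ \<phi>] exI[of _ s]) auto
qed

text \<open>The two sides are the scalar curvatures of the product at \<open>P\<close> and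
  \<open>Q\<close>, which the linear isometry supplied by \<open>hom\<close> forces to
  agree.\<close>

lemma scalar_curvature_of_curvature_homogeneous:
  assumes hom: "curvature_homogeneous 0 (M_space M) (M_metric t M g)"
    and P: "snd P \<in> points M" and Q: "snd Q \<in> points M"
  shows "exp (- t * fst P) * (scalar_curvature M g (snd P) - real DIM('e) * (real DIM('e) - 1) / 4 * t\<^sup>2) =
    exp (- t * fst Q) * (scalar_curvature M g (snd Q) - real DIM('e) * (real DIM('e) - 1) / 4 * t\<^sup>2)"
proof -
  obtain c where c: "c \<in> atlas M" "snd P \<in> fst c" "chart_at (M_space M) P = cylinder_chart c"
    using chart_at_M_space[OF P] .
  obtain d where d: "d \<in> atlas M" "snd Q \<in> fst d" "chart_at (M_space M) Q = cylinder_chart d"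
    using chart_at_M_space[OF Q] .
  interpret c: metric_field "snd c ` fst c" "local_metric M g c" by (rule metric_field_local_metric[OF c(1)])
  interpret d: metric_field "snd d ` fst d" "local_metric M g d" by (rule metric_field_local_metric[OF d(1)])
  have "P \<in> points (M_space M)" "Q \<in> points (M_space M)"
    unfolding points_M_space using P Q by (simp_all add: mem_Times_iff)
  then obtain \<phi> where iso: "linear_isometry (M_metric t M g) P Q \<phi>"
    and R0: "\<forall>l\<le>0. \<forall>vs. length vs = l + 4 \<longrightarrow> nabla_R (M_space M) (M_metric t M g) l Q (map \<phi> vs) =
      nabla_R (M_space M) (M_metric t M g) l P vs"
    using hom unfolding curvature_homogeneous_def by blast
  have R: "nabla_R (M_space M) (M_metric t M g) 0 Q (map \<phi> vs) = nabla_R (M_space M) (M_metric t M g) 0 P vs"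
    if "length vs = 4" for vs
    using R0[rule_format, of 0 vs] that by simp
  let ?zP = "(fst P, snd c (snd P))" and ?zQ = "(fst Q, snd d (snd Q))"
  have "local_scalar_curvature (warp t (local_metric M g d)) ?zQ =
      local_scalar_curvature (warp t (local_metric M g c)) ?zP"
  proof (rule scalar_curvature_linear_isometry[OF c.metric_field_warp _ d.metric_field_warp])
    show "linear \<phi>" "bij \<phi>" using iso by (auto simp: linear_isometry_def)
    show "warp t (local_metric M g d) ?zQ (\<phi> u) (\<phi> v) = warp t (local_metric M g c) ?zP u v" for u v
      using iso unfolding linear_isometry_def M_metric_warp[OF c] M_metric_warp[OF d] by blast
    show "curvature_tensor (warp t (local_metric M g d)) ?zQ (map \<phi> vs) =
        curvature_tensor (warp t (local_metric M g c)) ?zP vs" if "length vs = 4" for vs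
      using R[OF that] unfolding nabla_R_M_space[OF c] nabla_R_M_space[OF d] by simp
  qed (use c d in auto)
  then show ?thesis
    using c.scalar_curvature_warp[of ?zP t] d.scalar_curvature_warp[of ?zQ t] c(2) d(2)
    by (simp add: scalar_curvature_chart[OF c(1,2)] scalar_curvature_chart[OF d(1,2)])
qed

end

lemma (in Q_structure) transitive_isometry:
  assumes "p \<in> points N" "q \<in> points N"
  obtains f where "isometry N gN f" "f p = q"
  using unique_orbit[OF assms] action_isometry by blast

theorem theorem1p13:
  fixes N :: "('a, 'e::euclidean_space) manifold"
    and gN :: "'a \<Rightarrow> 'e \<Rightarrow> 'e \<Rightarrow> real"
    and G :: "'b monoid"
    and GM :: "('b, 'h::euclidean_space) manifold"
    and act :: "'b \<Rightarrow> 'a \<Rightarrow> 'a"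
    and \<theta> :: "'a \<Rightarrow> 'e \<Rightarrow> real"
    and m :: nat and p0 :: 'a and \<tau>\<^sub>N t :: real
  assumes "Q_structure N gN G GM act \<theta>"
    and "\<forall>p\<in>points N. \<forall>v. \<theta> p v = 0"
    and "m = DIM('e) + 1"
    and "p0 \<in> points N" and "\<tau>\<^sub>N = scalar_curvature N gN p0"
  shows "(\<forall>p\<in>points N. scalar_curvature N gN p = \<tau>\<^sub>N) \<and>
    (t \<noteq> 0 \<and> \<tau>\<^sub>N - (real m - 1) * (real m - 2) / 4 * t\<^sup>2 \<noteq> 0 \<longrightarrow>
       \<not> flat (M_space N) (M_metric t N gN) \<and>
       (\<forall>k. homothety_curvature_homogeneous k (M_space N) (M_metric t N gN)) \<and>
       \<not> curvature_homogeneous 0 (M_space N) (M_metric t N gN))"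
proof -
  interpret Q_structure N gN G GM act \<theta> by (rule assms(1))
  let ?M = "M_space N" and ?g = "M_metric t N gN"
  have const: "scalar_curvature N gN p = \<tau>\<^sub>N" if p: "p \<in> points N" for p
  proof -
    obtain f where "isometry N gN f" "f p0 = p" using transitive_isometry[OF assms(4) p] .
    then show ?thesis using scalar_curvature_isometry[of f p0] assms(4,5) by simp
  qed
  have homothety: "homothety_curvature_homogeneous k ?M ?g" for k
    unfolding homothety_curvature_homogeneous_def points_M_space
  proof (intro ballI)
    fix P Q :: "real \<times> 'a" assume "P \<in> UNIV \<times> points N" "Q \<in> UNIV \<times> points N"
    then have P: "snd P \<in> points N" and Q: "snd Q \<in> points N" by auto
    obtain f where "isometry N gN f" "f (snd P) = snd Q" using transitive_isometry[OF P Q] .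
    from homothety_nabla_R[OF this(1) P this(2)[symmetric]]
    show "\<exists>\<phi> (s::real). linear_isometry ?g P Q \<phi> \<and> s \<noteq> 0 \<and> (\<forall>l\<le>k. \<forall>vs. length vs = l + 4 \<longrightarrow>
        nabla_R ?M ?g l Q (map \<phi> vs) = s powi (- int l - 2) * nabla_R ?M ?g l P vs)"
      by blast
  qed
  have not_homogeneous: "\<not> curvature_homogeneous 0 ?M ?g"
    if t: "t \<noteq> 0" and \<tau>: "\<tau>\<^sub>N - (real m - 1) * (real m - 2) / 4 * t\<^sup>2 \<noteq> 0"
  proof
    assume "curvature_homogeneous 0 ?M ?g"
    \<comment> \<open>Two points over the same point of \<open>N\<close>, at \<open>x = 0\<close>
      and \<open>x = 1\<close>: a nonzero constant would equal \<open>exp (- t)\<close> times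
      itself, which forces \<open>t = 0\<close>.\<close>
    from scalar_curvature_of_curvature_homogeneous[OF this, of "(0, p0)" "(1, p0)"]
    have "\<tau>\<^sub>N - (real m - 1) * (real m - 2) / 4 * t\<^sup>2 =
        exp (- t) * (\<tau>\<^sub>N - (real m - 1) * (real m - 2) / 4 * t\<^sup>2)"
      by (simp add: assms(3,4) const)
    with \<tau> t show False by simp
  qed
  \<comment> \<open>The homothety property supplies only the linear isometry; both curvature tensors
    vanish, so it preserves them without rescaling.\<close>
  have "curvature_homogeneous 0 ?M ?g" if flat: "flat ?M ?g"
    unfolding curvature_homogeneous_def
  proof (intro ballI)
    fix P Q assume PQ: "P \<in> points ?M" "Q \<in> points ?M"
    then obtain \<phi> where "linear_isometry ?g P Q \<phi>"
      using homothety[of 0] unfolding homothety_curvature_homogeneous_def by blast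
    then show "\<exists>\<phi>. linear_isometry ?g P Q \<phi> \<and> (\<forall>l\<le>0. \<forall>vs. length vs = l + 4 \<longrightarrow>
        nabla_R ?M ?g l Q (map \<phi> vs) = nabla_R ?M ?g l P vs)"
      using flat PQ unfolding flat_def by (intro exI[of _ \<phi>]) simp
  qed
  then show ?thesis using const homothety not_homogeneous by blast
qed

end
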